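(* Let $\mathbb{K}$ be a field, $R=\mathbb{K}[x_1,\dots,x_n]$, $\mathbf{a}\in\mathbb{N}^n$, and let $I$ be an $\mathbf{a}$-determined (nonzero) stable ideal in $R$ generated in degree $2$. Write $$\operatorname{StaG}(I)=\{m_k=x_{k_1}x_{k_2}\mid1\le k\le g\},\qquad k_1\le k_2\text{ for each }k,$$ and put $h=\max\{k_1\mid1\le k\le g\}$ and $e=\max\{k_2\mid1\le k\le g\}$. For each $j\in\{1,\dots,n\}$ let $Y_j=\{i\in\{1,\dots,j\}\mid x_ix_j\in G(I)\}$. Set $$w_2=0+0+1+2+\cdots+(h-2)+(|Y_{h+1}|-1)+\cdots+(|Y_e|-1),$$ that is, $w_2=\sum_{j=2}^{h}(j-2)+\sum_{j=h+1}^{e}(|Y_j|-1)$, and $$w_1=2(h-1)+(e-h).$$ Then $$\beta_i(\widehat{I}^{[\mathbf{a}]})=w_2\binom{2}{i}+w_1\binom{1}{i},\qquad i=1,2.$$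
   Context: $G(I)$ is the minimal set of monomial generators of $I$. For a monomial $m$, $\max(m)$ is the largest index $i$ such that $x_i$ divides $m$; a monomial ideal $I$ is stable if for each monomial $m\in I$ and each $i<\max(m)$, $mx_i/x_{\max(m)}\in I$. For a non-empty set $T$ of monomials in $R$, $\operatorname{Sta}(T)$ is the unique smallest stable ideal of $R$ containing $T$; for a stable ideal $J$, $\operatorname{StaG}(J)$ is the unique smallest set $T$ of monomials with $\operatorname{Sta}(T)=J$. For $\mathbf{a}\in\mathbb{N}^n$ put $\mathbf{x}^{\mathbf{a}}=\prod_kx_k^{\mathbf{a}(k)}$. $I$ is $\mathbf{a}$-determined if every $f\in G(I)$ divides $\mathbf{x}^{\mathbf{a}}$; then $\widehat{I}^{[\mathbf{a}]}$ is the monomial ideal with minimal monomial generators $\mathbf{x}^{\mathbf{a}}/f$, $f\in G(I)$. $\beta_i(M)$ is the $i$-th total Betti number of the $R$-module $M$ (rank of the $i$-th module in its minimal graded free resolution). *)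

theory Defs
  imports
    "HOL-Library.Poly_Mapping"
    "HOL-Algebra.Ideal"
    "HOL-Algebra.Module"
    "HOL-Algebra.Divisibility"
begin

section \<open>The polynomial ring and its monomials\<close>

type_synonym expo = "nat \<Rightarrow>\<^sub>0 nat"
type_synonym 'k mpol = "expo \<Rightarrow>\<^sub>0 'k"

definition expos :: "nat \<Rightarrow> expo set" where
  "expos n = {b. Poly_Mapping.keys b \<subseteq> {1..n}}"

definition mdeg :: "expo \<Rightarrow> nat" where
  "mdeg b = (\<Sum>k\<in>Poly_Mapping.keys b. Poly_Mapping.lookup b k)"

definition polyR :: "nat \<Rightarrow> ('k::field mpol) ring" where
  "polyR n = \<lparr>carrier = {p. Poly_Mapping.keys p \<subseteq> expos n}, monoid.mult = (*), one = 1, zero = 0, add = (+)\<rparr>"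

definition xmon :: "expo \<Rightarrow> 'k::field mpol" where
  "xmon b = Poly_Mapping.single b 1"

definition xvar :: "nat \<Rightarrow> 'k::field mpol" where
  "xvar i = xmon (Poly_Mapping.single i 1)"

definition monomials :: "nat \<Rightarrow> ('k::field mpol) set" where
  "monomials n = xmon ` expos n"

lemma cring_polyR: "cring (polyR n :: ('k::field mpol) ring)"
proof -
  have sub: "p + q \<in> carrier (polyR n)" "p * q \<in> carrier (polyR n)"
    if pq: "p \<in> carrier (polyR n)" "q \<in> carrier (polyR n)" for p q :: "'k mpol"
  proof -
    show "p + q \<in> carrier (polyR n)"
      using pq Poly_Mapping.keys_add[of p q] by (auto simp: polyR_def)
    show "p * q \<in> carrier (polyR n)"
      using pq Poly_Mapping.keys_mult[of p q] Poly_Mapping.keys_add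
      by (fastforce simp: polyR_def expos_def)
  qed
  show ?thesis
  proof (rule cringI)
    show "abelian_group (polyR n :: ('k mpol) ring)"
    proof (rule abelian_groupI)
      fix p :: "'k mpol" assume "p \<in> carrier (polyR n)"
      then have "- p \<in> carrier (polyR n)" "- p + p = 0"
        by (auto simp: polyR_def)
      then show "\<exists>q\<in>carrier (polyR n). q \<oplus>\<^bsub>polyR n\<^esub> p = \<zero>\<^bsub>polyR n\<^esub>"
        by (intro bexI[of _ "- p"]) (auto simp: polyR_def)
    qed (use sub in \<open>auto simp: polyR_def algebra_simps\<close>)
    show "Group.comm_monoid (polyR n :: ('k mpol) ring)"
      by (rule comm_monoidI)
        (use sub in \<open>auto simp: polyR_def algebra_simps expos_def\<close>)
  qed (auto simp: polyR_def algebra_simps)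
qed

section \<open>Monomial ideals and stable ideals\<close>

definition monomial_ideal :: "nat \<Rightarrow> ('k::field mpol) set \<Rightarrow> bool" where
  "monomial_ideal n I \<longleftrightarrow> (\<exists>S \<subseteq> monomials n. I = Idl\<^bsub>polyR n\<^esub> S)"

definition mgens :: "nat \<Rightarrow> ('k::field mpol) set \<Rightarrow> ('k mpol) set" where
  "mgens n I = (LEAST S. S \<subseteq> monomials n \<and> Idl\<^bsub>polyR n\<^esub> S = I)"

definition generated_in_degree :: "nat \<Rightarrow> ('k::field mpol) set \<Rightarrow> nat \<Rightarrow> bool" where
  "generated_in_degree n I d \<longleftrightarrow> (\<forall>b. xmon b \<in> mgens n I \<longrightarrow> mdeg b = d)"

text \<open>For the monomial 1 there is no largest variable; the value 0 makes the stability
  condition vacuous there.\<close>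

definition maxvar :: "expo \<Rightarrow> nat" where
  "maxvar b = (if b = 0 then 0 else Max (Poly_Mapping.keys b))"

definition stable_ideal :: "nat \<Rightarrow> ('k::field mpol) set \<Rightarrow> bool" where
  "stable_ideal n I \<longleftrightarrow> monomial_ideal n I \<and>
    (\<forall>b\<in>expos n. xmon b \<in> I \<longrightarrow>
      (\<forall>i. 1 \<le> i \<and> i < maxvar b \<longrightarrow>
        xmon (b - Poly_Mapping.single (maxvar b) 1 + Poly_Mapping.single i 1) \<in> I))"

definition Sta :: "nat \<Rightarrow> ('k::field mpol) set \<Rightarrow> ('k mpol) set" where
  "Sta n T = (LEAST J. stable_ideal n J \<and> T \<subseteq> J)"

definition StaG :: "nat \<Rightarrow> ('k::field mpol) set \<Rightarrow> ('k mpol) set" where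
  "StaG n J = (LEAST T. T \<subseteq> monomials n \<and> T \<noteq> {} \<and> Sta n T = J)"

section \<open>The dual with respect to an exponent vector\<close>

definition determined :: "nat \<Rightarrow> expo \<Rightarrow> ('k::field mpol) set \<Rightarrow> bool" where
  "determined n a I \<longleftrightarrow> (\<forall>f\<in>mgens n I. f divides\<^bsub>polyR n\<^esub> xmon a)"

text \<open>The subtraction of exponent vectors is truncated, but it is exact when \<open>I\<close> is
  \<open>a\<close>-determined.\<close>

definition adual :: "nat \<Rightarrow> expo \<Rightarrow> ('k::field mpol) set \<Rightarrow> ('k mpol) set" where
  "adual n a I = Idl\<^bsub>polyR n\<^esub> {xmon (a - b) | b. xmon b \<in> mgens n I}"

section \<open>Minimal graded free resolutions and Betti numbers\<close>

text \<open>All degrees refer to the standard grading, in which every variable has degree 1. The zero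
  polynomial is homogeneous of every degree.\<close>

definition homog :: "int \<Rightarrow> ('k::field mpol) \<Rightarrow> bool" where
  "homog d p \<longleftrightarrow> (\<forall>b\<in>Poly_Mapping.keys p. int (mdeg b) = d)"

text \<open>The fields \<open>mult\<close> and \<open>one\<close> of a module record play no role.\<close>

definition ideal_module :: "('k::field mpol) set \<Rightarrow> ('k mpol, 'k mpol) module" where
  "ideal_module I = \<lparr>carrier = I, monoid.mult = (*), one = 1, zero = 0, add = (+), smult = (*)\<rparr>"

definition ideal_component :: "('k::field mpol) set \<Rightarrow> int \<Rightarrow> ('k mpol) set" where
  "ideal_component I d = {p \<in> I. homog d p}"

text \<open>The free module of rank \<open>r\<close>, on the index set \<open>{..<r}\<close>.\<close>

definition free_module :: "nat \<Rightarrow> nat \<Rightarrow> ('k::field mpol, nat \<Rightarrow> 'k mpol) module" where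
  "free_module n r =
    \<lparr>carrier = {v. (\<forall>j<r. v j \<in> carrier (polyR n)) \<and> (\<forall>j\<ge>r. v j = 0)},
     monoid.mult = undefined, one = undefined, zero = (\<lambda>_. 0),
     add = (\<lambda>u v j. u j + v j), smult = (\<lambda>p v j. p * v j)\<rparr>"

text \<open>Degree \<open>d\<close> part of the direct sum of the shifted modules $R(-s_j)$, \<open>j < r\<close>; thus
  the \<open>j\<close>-th basis vector has degree \<open>s j\<close>.\<close>

definition free_component ::
    "nat \<Rightarrow> nat \<Rightarrow> (nat \<Rightarrow> int) \<Rightarrow> int \<Rightarrow> (nat \<Rightarrow> 'k::field mpol) set" where
  "free_component n r s d = {v \<in> carrier (free_module n r). \<forall>j<r. homog (d - s j) (v j)}"

definition mod_hom ::
    "('r, 'a) ring_scheme \<Rightarrow> ('r, 'm, 'b) module_scheme \<Rightarrow> ('r, 'l, 'c) module_scheme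
      \<Rightarrow> ('m \<Rightarrow> 'l) \<Rightarrow> bool" where
  "mod_hom R M N f \<longleftrightarrow>
    (\<forall>u\<in>carrier M. f u \<in> carrier N) \<and>
    (\<forall>u\<in>carrier M. \<forall>v\<in>carrier M. f (u \<oplus>\<^bsub>M\<^esub> v) = f u \<oplus>\<^bsub>N\<^esub> f v) \<and>
    (\<forall>p\<in>carrier R. \<forall>u\<in>carrier M. f (p \<odot>\<^bsub>M\<^esub> u) = p \<odot>\<^bsub>N\<^esub> f u)"

definition mod_ker ::
    "('r, 'm, 'b) module_scheme \<Rightarrow> ('r, 'l, 'c) module_scheme \<Rightarrow> ('m \<Rightarrow> 'l) \<Rightarrow> 'm set" where
  "mod_ker M N f = {u \<in> carrier M. f u = \<zero>\<^bsub>N\<^esub>}"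

text \<open>\<open>M\<close> is a graded module with graded components \<open>gr d\<close>. The resolution is
  \<open>\<dots> \<rightarrow> F 2 \<rightarrow> F 1 \<rightarrow> F 0 \<rightarrow> M \<rightarrow> 0\<close>, where \<open>F i\<close> is free of finite rank \<open>r i\<close> with shifts
  \<open>s i\<close>, the map from \<open>F (i + 1)\<close> to \<open>F i\<close> is \<open>d i\<close>, and \<open>aug\<close> is the augmentation. The last
  clause is minimality: the image of \<open>d i\<close> lies in $(x_1,\dots,x_n) F_i$, that is, its elements
  have coordinates with zero constant term.\<close>

definition minimal_graded_free_resolution ::
    "nat \<Rightarrow> ('k::field mpol, 'm) module \<Rightarrow> (int \<Rightarrow> 'm set) \<Rightarrow>
     (nat \<Rightarrow> nat) \<Rightarrow> (nat \<Rightarrow> nat \<Rightarrow> int) \<Rightarrow>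
     (nat \<Rightarrow> (nat \<Rightarrow> 'k mpol) \<Rightarrow> (nat \<Rightarrow> 'k mpol)) \<Rightarrow> ((nat \<Rightarrow> 'k mpol) \<Rightarrow> 'm) \<Rightarrow> bool" where
  "minimal_graded_free_resolution n M gr r s d aug \<longleftrightarrow>
    (let F = (\<lambda>i. free_module n (r i)) in
      mod_hom (polyR n) (F 0) M aug \<and>
      (\<forall>i. mod_hom (polyR n) (F (Suc i)) (F i) (d i)) \<and>
      (\<forall>e. aug ` free_component n (r 0) (s 0) e \<subseteq> gr e) \<and>
      (\<forall>i e. d i ` free_component n (r (Suc i)) (s (Suc i)) e \<subseteq> free_component n (r i) (s i) e) \<and>
      aug ` carrier (F 0) = carrier M \<and>
      mod_ker (F 0) M aug = d 0 ` carrier (F (Suc 0)) \<and>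
      (\<forall>i. mod_ker (F (Suc i)) (F i) (d i) = d (Suc i) ` carrier (F (Suc (Suc i)))) \<and>
      (\<forall>i. \<forall>v\<in>carrier (F (Suc i)). \<forall>j<r i. Poly_Mapping.lookup (d i v j) 0 = 0))"

definition betti ::
    "nat \<Rightarrow> ('k::field mpol, 'm) module \<Rightarrow> (int \<Rightarrow> 'm set) \<Rightarrow> nat \<Rightarrow> nat" where
  "betti n M gr i =
    (THE b. \<exists>r s d aug. minimal_graded_free_resolution n M gr r s d aug \<and> b = r i)"

abbreviation betti_ideal :: "nat \<Rightarrow> ('k::field mpol) set \<Rightarrow> nat \<Rightarrow> nat" where
  "betti_ideal n J i \<equiv> betti n (ideal_module J) (ideal_component J) i"

lemma module_ideal_module:
  fixes J :: "('k::field mpol) set"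
  assumes "ideal J (polyR n)"
  shows "module (polyR n) (ideal_module J)"
proof -
  interpret ideal J "polyR n" by fact
  have zero: "0 \<in> J" and add: "\<And>p q. p \<in> J \<Longrightarrow> q \<in> J \<Longrightarrow> p + q \<in> J"
    using additive_subgroup.zero_closed[OF is_additive_subgroup]
      additive_subgroup.a_closed[OF is_additive_subgroup]
    by (auto simp: polyR_def)
  have mul: "\<And>p q. p \<in> carrier (polyR n) \<Longrightarrow> q \<in> J \<Longrightarrow> p * q \<in> J"
    using I_l_closed by (auto simp: polyR_def)
  have neg: "- p \<in> J" if "p \<in> J" for p
  proof -
    have "- 1 \<in> carrier (polyR n :: ('k mpol) ring)"
      by (auto simp: polyR_def expos_def)
    from mul[OF this that] show ?thesis by simp
  qed
  show ?thesis
  proof (rule moduleI)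
    show "cring (polyR n :: ('k mpol) ring)"
      by (rule cring_polyR)
    show "abelian_group (ideal_module J)"
    proof (rule abelian_groupI)
      fix p assume "p \<in> carrier (ideal_module J)"
      then show "\<exists>q\<in>carrier (ideal_module J). q \<oplus>\<^bsub>ideal_module J\<^esub> p = \<zero>\<^bsub>ideal_module J\<^esub>"
        using neg[of p] by (intro bexI[of _ "- p"]) (auto simp: ideal_module_def)
    qed (use zero add in \<open>auto simp: ideal_module_def algebra_simps\<close>)
  qed (use mul in \<open>auto simp: ideal_module_def algebra_simps polyR_def\<close>)
qed

lemma module_free_module:
  "module (polyR n) (free_module n r :: ('k::field mpol, nat \<Rightarrow> 'k mpol) module)"
proof -
  interpret R: cring "polyR n :: ('k mpol) ring" by (rule cring_polyR)
  have cl: "0 \<in> carrier (polyR n :: ('k mpol) ring)"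
      "\<And>p q. p \<in> carrier (polyR n) \<Longrightarrow> q \<in> carrier (polyR n) \<Longrightarrow> p + q \<in> carrier (polyR n :: ('k mpol) ring)"
      "\<And>p q. p \<in> carrier (polyR n) \<Longrightarrow> q \<in> carrier (polyR n) \<Longrightarrow> p * q \<in> carrier (polyR n :: ('k mpol) ring)"
      "\<And>p. p \<in> carrier (polyR n) \<Longrightarrow> - p \<in> carrier (polyR n :: ('k mpol) ring)"
    using R.zero_closed R.add.m_closed R.m_closed by (auto simp: polyR_def)
  show ?thesis
  proof (rule moduleI)
    show "cring (polyR n :: ('k mpol) ring)"
      by (rule cring_polyR)
    show "abelian_group (free_module n r :: ('k mpol, nat \<Rightarrow> 'k mpol) module)"
    proof (rule abelian_groupI)
      fix v :: "nat \<Rightarrow> 'k mpol" assume "v \<in> carrier (free_module n r)"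
      then show "\<exists>u\<in>carrier (free_module n r). u \<oplus>\<^bsub>free_module n r\<^esub> v = \<zero>\<^bsub>free_module n r\<^esub>"
        by (intro bexI[of _ "\<lambda>j. - v j"]) (auto simp: free_module_def intro: cl)
    qed (use cl in \<open>auto simp: free_module_def algebra_simps\<close>)
  qed (use cl in \<open>auto simp: free_module_def polyR_def algebra_simps\<close>)
qed

end

theory Submission
  imports Defs "HOL-Library.Function_Algebras" "HOL.Vector_Spaces"
begin

text \<open>Let \<open>P\<close> be the set of pairs $i \le j$ with $x_ix_j \in G(I)$. Stability gives
  $\{i \le j \le h\} \subseteq P$ and $i \le h$, $j \le e$ for $(i,j) \in P$. Add the generators
  $x^{\mathbf a}/(x_ix_j)$ of the dual column by column, i.e. by increasing \<open>j\<close>, with $x_j^2$ last in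
  its column. The colon ideal of the earlier generators by $x^{\mathbf a}/(x_ix_j)$ is then $0$ for
  $x_1^2$, $(x_j)$ for the first element of a column and for $x_j^2$, and $(x_i, x_j)$ otherwise.
  Hence the iterated mapping cone is a linear, so minimal, resolution in which a colon ideal
  generated by \<open>q\<close> variables contributes $\binom{q}{i}$ to the \<open>i\<close>-th rank; $q = 1$ occurs
  $w_1$ times and $q = 2$ occurs $w_2$ times. The resolutions of $(x_j)$ and $(x_i,x_j)$ are
  themselves instances of the cone construction.\<close>

section \<open>Polynomials\<close>

text \<open>The colon ideal of x^a/(x_k x_l) by x^a/(x_i x_j) is generated by x_i x_j / gcd(x_i x_j,
  x_k x_l). For i < j the earlier pair x_1 x_i gives the quotient x_j, which divides all quotients
  coming from earlier columns; an earlier x_k x_j in the same column adds x_i. For x_j^2 with j > 1,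
  an earlier x_i x_j gives x_j. The triangle comes from the member of StaG(I) with first entry h:
  its larger variable can be traded for x_h, so x_h^2 is in I and every x_i x_j with i <= j <= h
  follows. The constants: a column j with 2 <= j <= h has j - 1 members before its square, so it
  counts j - 2 for w_2 and, with the square, 2 for w_1. A column j > h has no square because i <= h,
  so it counts |Y_j| - 1 for w_2 and 1 for w_1. Betti numbers are defined by a definite description,
  so exhibiting one minimal resolution is not enough: the ranks of any two must be proved equal.
  Likewise StaG is a least element whose existence has to be shown; it is identified with the pairs
  that no stability move produces.\<close>

lemma polyR_simps:
  "\<zero>\<^bsub>polyR n\<^esub> = 0" "\<one>\<^bsub>polyR n\<^esub> = 1" "p \<oplus>\<^bsub>polyR n\<^esub> q = p + q" "p \<otimes>\<^bsub>polyR n\<^esub> q = p * q"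
  by (auto simp: polyR_def)

lemma in_polyR: "p \<in> carrier (polyR n) \<longleftrightarrow> Poly_Mapping.keys p \<subseteq> expos n"
  by (auto simp: polyR_def)

lemma polyR_zero: "0 \<in> carrier (polyR n)"
  and polyR_one: "1 \<in> carrier (polyR n)"
  by (auto simp: in_polyR expos_def)

lemma polyR_add: "p \<in> carrier (polyR n) \<Longrightarrow> q \<in> carrier (polyR n) \<Longrightarrow> p + q \<in> carrier (polyR n)"
  for p q :: "'k::field mpol"
  using ring.ring_simprules(1)[OF cring.axioms(1)[OF cring_polyR], of p n q] by (simp add: polyR_simps)

lemma polyR_mult: "p \<in> carrier (polyR n) \<Longrightarrow> q \<in> carrier (polyR n) \<Longrightarrow> p * q \<in> carrier (polyR n)"
  for p q :: "'k::field mpol"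
  using ring.ring_simprules(5)[OF cring.axioms(1)[OF cring_polyR], of p n q] by (simp add: polyR_simps)

lemma polyR_uminus: "p \<in> carrier (polyR n) \<Longrightarrow> - p \<in> carrier (polyR n)"
  by (auto simp: in_polyR)

lemma polyR_diff: "p \<in> carrier (polyR n) \<Longrightarrow> q \<in> carrier (polyR n) \<Longrightarrow> p - q \<in> carrier (polyR n)"
  for p q :: "'k::field mpol"
  using polyR_add[of p n "- q"] polyR_uminus by fastforce

lemma polyR_sum: "(\<And>x. x \<in> X \<Longrightarrow> p x \<in> carrier (polyR n)) \<Longrightarrow> sum p X \<in> carrier (polyR n)"
  for p :: "'a \<Rightarrow> 'k::field mpol"
  by (induction X rule: infinite_finite_induct) (auto intro: polyR_zero polyR_add)

section \<open>Splitting a polynomial along a set of exponents\<close>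

definition restr :: "'a set \<Rightarrow> ('a \<Rightarrow>\<^sub>0 'b::zero) \<Rightarrow> ('a \<Rightarrow>\<^sub>0 'b)" where
  "restr A = Poly_Mapping.mapp (\<lambda>b c. if b \<in> A then c else 0)"

lemma lookup_restr: "Poly_Mapping.lookup (restr A p) b = (if b \<in> A then Poly_Mapping.lookup p b else 0)"
  by (auto simp: restr_def lookup_mapp when_def in_keys_iff)

lemma keys_restr: "Poly_Mapping.keys (restr A p) = Poly_Mapping.keys p \<inter> A"
  by (auto simp: in_keys_iff lookup_restr split: if_splits)

lemma restr_add: "restr A (p + q) = restr A p + restr A q"
  by (rule poly_mapping_eqI) (auto simp: lookup_restr lookup_add)

lemma restr_zero [simp]: "restr A 0 = 0"
  by (rule poly_mapping_eqI) (auto simp: lookup_restr)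

lemma restr_sum: "restr A (sum p X) = (\<Sum>x\<in>X. restr A (p x))"
  by (induction X rule: infinite_finite_induct) (auto simp: restr_add)

lemma restr_id: "Poly_Mapping.keys p \<subseteq> A \<Longrightarrow> restr A p = p"
  by (rule poly_mapping_eqI) (auto simp: lookup_restr in_keys_iff)

lemma restr_disjoint: "Poly_Mapping.keys p \<inter> A = {} \<Longrightarrow> restr A p = 0"
  by (rule poly_mapping_eqI) (auto simp: lookup_restr in_keys_iff disjoint_iff)

lemma restr_split: "p = restr A p + restr (- A) p"
  by (rule poly_mapping_eqI) (auto simp: lookup_restr lookup_add)

lemma restr_polyR: "p \<in> carrier (polyR n) \<Longrightarrow> restr A p \<in> carrier (polyR n)"
  by (auto simp: in_polyR keys_restr)

text \<open>Exponents are natural numbers, so x + y = 0 forces x = y = 0 and no other terms meet in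
  the constant one. Taking constant terms is reduction modulo the variables; it turns maps of free
  modules into matrices over the field.\<close>

lemma lookup_mult_zero:
  fixes p q :: "'k::field mpol"
  shows "Poly_Mapping.lookup (p * q) 0 = Poly_Mapping.lookup p 0 * Poly_Mapping.lookup q 0"
proof -
  have const: "restr {0} p = Poly_Mapping.single 0 (Poly_Mapping.lookup p 0)" for p :: "'k mpol"
    by (rule poly_mapping_eqI) (auto simp: lookup_restr lookup_single when_def)
  have nz: "Poly_Mapping.lookup (p * q) 0 = 0"
    if "0 \<notin> Poly_Mapping.keys p \<or> 0 \<notin> Poly_Mapping.keys q" for p q :: "'k mpol"
  proof -
    have "x + y = 0 \<Longrightarrow> x = 0 \<and> y = 0" for x y :: expo
      by (metis add_is_0 lookup_add lookup_zero poly_mapping_eqI)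
    then have "0 = x + y \<Longrightarrow> x = 0 \<and> y = 0" for x y :: expo
      by metis
    then have "0 \<notin> Poly_Mapping.keys (p * q)"
      using keys_mult[of p q] that by blast
    then show ?thesis by (simp add: in_keys_iff)
  qed
  define p0 q0 where "p0 = restr {0} p" and "q0 = restr {0} q"
  define p1 q1 where "p1 = restr (- {0}) p" and "q1 = restr (- {0}) q"
  have pq: "p = p0 + p1" "q = q0 + q1"
    unfolding p0_def p1_def q0_def q1_def by (rule restr_split)+
  have "p * q = p0 * q0 + p1 * q0 + p * q1"
    using pq distrib_left[of p q0 q1] distrib_right[of p0 p1 q0] by argo
  moreover have "Poly_Mapping.lookup (p1 * q0) 0 = 0" "Poly_Mapping.lookup (p * q1) 0 = 0"
    by (rule nz; simp add: p1_def q1_def keys_restr)+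
  moreover have "Poly_Mapping.lookup (p0 * q0) 0 = Poly_Mapping.lookup p 0 * Poly_Mapping.lookup q 0"
    by (simp add: p0_def q0_def const mult_single)
  ultimately show ?thesis by (simp add: lookup_add)
qed

lemma lookup_xmon_mult:
  fixes p :: "'k::field mpol"
  shows "Poly_Mapping.lookup (xmon m * p) (m + b) = Poly_Mapping.lookup p b"
proof -
  have "Poly_Mapping.lookup (xmon m * restr (- {b}) p) (m + b) = 0"
    using keys_mult[of "xmon m :: 'k mpol" "restr (- {b}) p"]
    by (fastforce simp: xmon_def keys_restr in_keys_iff[symmetric] not_in_keys_iff_lookup_eq_zero[symmetric])
  moreover have "restr {b} p = Poly_Mapping.single b (Poly_Mapping.lookup p b)"
    by (rule poly_mapping_eqI) (auto simp: lookup_restr lookup_single when_def)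
  ultimately show ?thesis
    by (subst restr_split[of p "{b}"]) (simp add: distrib_left lookup_add xmon_def mult_single)
qed

text \<open>Translation by \<open>m\<close> is injective on exponents, so no terms cancel; this
  gives equality where \<open>keys_mult\<close> gives an inclusion.\<close>

lemma keys_xmon_mult:
  fixes p :: "'k::field mpol"
  shows "Poly_Mapping.keys (xmon m * p) = (+) m ` Poly_Mapping.keys p"
proof
  show "Poly_Mapping.keys (xmon m * p) \<subseteq> (+) m ` Poly_Mapping.keys p"
    using keys_mult[of "xmon m" p] by (auto simp: xmon_def)
  show "(+) m ` Poly_Mapping.keys p \<subseteq> Poly_Mapping.keys (xmon m * p)"
    by (auto simp: in_keys_iff lookup_xmon_mult)
qed

lemma xmon_mult: "xmon b * xmon c = xmon (b + c)"
  by (simp add: xmon_def mult_single)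

lemma keys_xmon [simp]: "Poly_Mapping.keys (xmon b :: 'k::field mpol) = {b}"
  by (simp add: xmon_def)

lemma inj_xmon: "inj (xmon :: expo \<Rightarrow> 'k::field mpol)"
  by (metis injI keys_xmon singleton_inject)

subsection \<open>Degrees\<close>

lemma mdeg_supset: "finite X \<Longrightarrow> Poly_Mapping.keys b \<subseteq> X \<Longrightarrow> mdeg b = (\<Sum>k\<in>X. Poly_Mapping.lookup b k)"
  unfolding mdeg_def by (rule sum.mono_neutral_left) (auto simp: in_keys_iff)

lemma mdeg_add: "mdeg (b + c) = mdeg b + mdeg c"
proof -
  let ?X = "Poly_Mapping.keys b \<union> Poly_Mapping.keys c"
  have "mdeg (b + c) = (\<Sum>k\<in>?X. Poly_Mapping.lookup (b + c) k)"
    using keys_add[of b c] by (intro mdeg_supset) auto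
  also have "\<dots> = mdeg b + mdeg c"
    by (simp add: lookup_add sum.distrib mdeg_supset[of ?X])
  finally show ?thesis .
qed

lemma mdeg_zero [simp]: "mdeg 0 = 0"
  by (simp add: mdeg_def)

lemma mdeg_single [simp]: "mdeg (Poly_Mapping.single i c) = c"
  by (simp add: mdeg_def)

lemma homog_zero [simp]: "homog d 0"
  by (simp add: homog_def)

lemma homog_one: "homog 0 1"
  by (simp add: homog_def)

lemma homog_add: "homog d p \<Longrightarrow> homog d q \<Longrightarrow> homog d (p + q)"
  using keys_add[of p q] by (auto simp: homog_def)

lemma homog_uminus: "homog d p \<Longrightarrow> homog d (- p)"
  by (simp add: homog_def)

lemma homog_sum: "(\<And>x. x \<in> X \<Longrightarrow> homog d (p x)) \<Longrightarrow> homog d (sum p X)"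
  by (induction X rule: infinite_finite_induct) (auto simp: homog_add)

lemma homog_mult: "homog d p \<Longrightarrow> homog e q \<Longrightarrow> homog (d + e) (p * q)"
  using keys_mult[of p q] by (force simp: homog_def mdeg_add)

lemma homog_lookup_zero: "homog d p \<Longrightarrow> d \<noteq> 0 \<Longrightarrow> Poly_Mapping.lookup p 0 = 0"
  by (force simp: homog_def in_keys_iff)

definition hcomp :: "int \<Rightarrow> 'k::field mpol \<Rightarrow> 'k mpol" where
  "hcomp d = restr {b. int (mdeg b) = d}"

lemma homog_hcomp: "homog d (hcomp d p)"
  by (auto simp: homog_def hcomp_def keys_restr)

lemma hcomp_homog: "homog d p \<Longrightarrow> hcomp d p = p"
  by (auto simp: homog_def hcomp_def intro: restr_id)

text \<open>Since \<open>q\<close> lives in the single degree \<open>t\<close>, a term of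
  \<open>p\<close> contributes to degree \<open>d\<close> of the product exactly when it has degree
  \<open>d - t\<close>.\<close>

lemma hcomp_mult:
  assumes "homog t q"
  shows "hcomp d (p * q) = hcomp (d - t) p * q"
proof -
  let ?A = "{b. int (mdeg b) = d - t}"
  have "p * q = restr ?A p * q + restr (- ?A) p * q"
    by (metis distrib_right restr_split)
  moreover have "hcomp d (restr ?A p * q) = restr ?A p * q"
    using homog_mult[OF homog_hcomp[of "d - t" p] assms] hcomp_homog[of d "hcomp (d - t) p * q"]
    by (simp add: hcomp_def)
  moreover have "hcomp d (restr (- ?A) p * q) = 0"
    unfolding hcomp_def
  proof (rule restr_disjoint, rule equals0I)
    fix b assume "b \<in> Poly_Mapping.keys (restr (- ?A) p * q) \<inter> {b. int (mdeg b) = d}"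
    moreover from this obtain x y where "b = x + y" "x \<in> Poly_Mapping.keys (restr (- ?A) p)"
        "y \<in> Poly_Mapping.keys q"
      using keys_mult[of "restr (- ?A) p" q] by blast
    ultimately show False
      using assms by (auto simp: homog_def keys_restr mdeg_add)
  qed
  ultimately show ?thesis
    by (simp add: hcomp_def restr_add)
qed

lemma hcomp_sum: "hcomp d (sum p X) = (\<Sum>x\<in>X. hcomp d (p x))"
  by (simp add: hcomp_def restr_sum)

section \<open>Graded maps between free modules\<close>

abbreviation vecs :: "nat \<Rightarrow> nat \<Rightarrow> (nat \<Rightarrow> 'k::field mpol) set" where
  "vecs n r \<equiv> carrier (free_module n r)"

lemma in_vecs: "v \<in> vecs n r \<longleftrightarrow> (\<forall>j. v j \<in> carrier (polyR n)) \<and> (\<forall>j\<ge>r. v j = 0)"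
  by (auto simp: free_module_def) (metis not_le polyR_zero)

lemma vecsD: "v \<in> vecs n r \<Longrightarrow> v j \<in> carrier (polyR n)" "v \<in> vecs n r \<Longrightarrow> j \<ge> r \<Longrightarrow> v j = 0"
  by (auto simp: in_vecs)

lemma vecs_zero: "0 \<in> vecs n r"
  by (auto simp: in_vecs polyR_zero)

lemma vecs_add: "u \<in> vecs n r \<Longrightarrow> v \<in> vecs n r \<Longrightarrow> u + v \<in> vecs n r"
  by (auto simp: in_vecs polyR_add)

lemma vecs_uminus: "u \<in> vecs n r \<Longrightarrow> - u \<in> vecs n r"
  by (auto simp: in_vecs polyR_uminus)

lemma vecs_diff: "u \<in> vecs n r \<Longrightarrow> v \<in> vecs n r \<Longrightarrow> u - v \<in> vecs n r"
  by (auto simp: in_vecs polyR_diff)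

lemma vecs_scale: "p \<in> carrier (polyR n) \<Longrightarrow> u \<in> vecs n r \<Longrightarrow> (\<lambda>j. p * u j) \<in> vecs n r"
  by (auto simp: in_vecs polyR_mult)

lemma vecs_0: "vecs n 0 = {0}"
  by (auto simp: in_vecs polyR_zero)

lemma in_free_component:
  "v \<in> free_component n r s d \<longleftrightarrow> v \<in> vecs n r \<and> (\<forall>j. homog (d - s j) (v j))"
  by (auto simp: free_component_def in_vecs) (metis homog_zero not_le)

definition unit :: "nat \<Rightarrow> nat \<Rightarrow> 'k::field mpol" where
  "unit j = (\<lambda>i. if i = j then 1 else 0)"

lemma unit_vecs: "j < r \<Longrightarrow> unit j \<in> vecs n r"
  by (auto simp: in_vecs unit_def polyR_zero polyR_one)

lemma unit_free_component: "j < r \<Longrightarrow> unit j \<in> free_component n r s (s j)"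
  by (auto simp: in_free_component unit_vecs) (auto simp: unit_def homog_one)

definition grhom :: "nat \<Rightarrow> nat \<Rightarrow> (nat \<Rightarrow> int) \<Rightarrow> nat \<Rightarrow> (nat \<Rightarrow> int) \<Rightarrow>
    ((nat \<Rightarrow> 'k::field mpol) \<Rightarrow> nat \<Rightarrow> 'k mpol) \<Rightarrow> bool" where
  "grhom n r s r' s' f \<longleftrightarrow> mod_hom (polyR n) (free_module n r) (free_module n r') f \<and>
     (\<forall>d. f ` free_component n r s d \<subseteq> free_component n r' s' d)"

lemma grhom_iff: "grhom n r s r' s' f \<longleftrightarrow>
  (\<forall>u\<in>vecs n r. f u \<in> vecs n r') \<and>
  (\<forall>u\<in>vecs n r. \<forall>v\<in>vecs n r. f (u + v) = f u + f v) \<and>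
  (\<forall>p\<in>carrier (polyR n). \<forall>u\<in>vecs n r. f (\<lambda>j. p * u j) = (\<lambda>j. p * f u j)) \<and>
  (\<forall>d. \<forall>u\<in>free_component n r s d. f u \<in> free_component n r' s' d)"
  by (auto simp: grhom_def mod_hom_def free_module_def plus_fun_def image_subset_iff)

context
  fixes n r s r' s' and f :: "(nat \<Rightarrow> 'k::field mpol) \<Rightarrow> nat \<Rightarrow> 'k mpol"
  assumes f: "grhom n r s r' s' f"
begin

lemma grhom_closed: "u \<in> vecs n r \<Longrightarrow> f u \<in> vecs n r'"
  and grhom_add: "u \<in> vecs n r \<Longrightarrow> v \<in> vecs n r \<Longrightarrow> f (u + v) = f u + f v"
  and grhom_scale: "p \<in> carrier (polyR n) \<Longrightarrow> u \<in> vecs n r \<Longrightarrow> f (\<lambda>j. p * u j) = (\<lambda>j. p * f u j)"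
  and grhom_component: "u \<in> free_component n r s d \<Longrightarrow> f u \<in> free_component n r' s' d"
  using f by (auto simp: grhom_iff)

lemma grhom_zero: "f 0 = 0"
  using grhom_scale[OF polyR_zero vecs_zero] by (simp add: zero_fun_def)

lemma grhom_uminus: "u \<in> vecs n r \<Longrightarrow> f (- u) = - f u"
  using grhom_scale[OF polyR_uminus[OF polyR_one], of u] by (simp add: fun_Compl_def)

lemma grhom_diff: "u \<in> vecs n r \<Longrightarrow> v \<in> vecs n r \<Longrightarrow> f (u - v) = f u - f v"
  using grhom_add[of u "- v"] grhom_uminus[of v] by (simp add: vecs_uminus)

text \<open>The matrix of a map: degrees and constant terms then only have to be known on basis
  vectors.\<close>

lemma grhom_expand:
  assumes v: "v \<in> vecs n r"
  shows "f v i = (\<Sum>j<r. v j * f (unit j) i)"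
proof -
  have "f (\<lambda>j. if j < m then v j else 0) i = (\<Sum>j<m. v j * f (unit j) i)" if "m \<le> r" for m
    using that
  proof (induction m)
    case 0
    show ?case using grhom_zero by (simp add: zero_fun_def)
  next
    case (Suc m)
    have "(\<lambda>j. if j < Suc m then v j else 0) = (\<lambda>j. if j < m then v j else 0) + (\<lambda>j. v m * unit m j)"
      by (auto simp: unit_def fun_eq_iff less_Suc_eq)
    moreover have "f \<dots> = f (\<lambda>j. if j < m then v j else 0) + f (\<lambda>j. v m * unit m j)"
      using v Suc.prems by (intro grhom_add vecs_scale unit_vecs) (auto simp: in_vecs polyR_zero)
    moreover have "f (\<lambda>j. v m * unit m j) = (\<lambda>j. v m * f (unit m) j)"
      using v Suc.prems by (intro grhom_scale unit_vecs) (auto simp: in_vecs)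
    ultimately show ?case using Suc by simp
  qed
  from this[of r] have "f (\<lambda>j. if j < r then v j else 0) i = (\<Sum>j<r. v j * f (unit j) i)"
    by simp
  moreover have "(\<lambda>j. if j < r then v j else 0) = v"
    using v by (auto simp: in_vecs)
  ultimately show ?thesis by simp
qed

text \<open>The matrix entry in row \<open>i\<close> and column \<open>j\<close> is homogeneous of
  degree \<open>s j - s' i\<close>, so a degree-preserving map commutes with homogeneous
  components.\<close>

lemma grhom_hcomp:
  assumes v: "v \<in> vecs n r"
  shows "f (\<lambda>j. hcomp (d - s j) (v j)) = (\<lambda>i. hcomp (d - s' i) (f v i))"
proof
  fix i
  let ?v = "\<lambda>j. hcomp (d - s j) (v j)"
  have "?v \<in> vecs n r"
    using v by (auto simp: in_vecs hcomp_def restr_polyR)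
  then have "f ?v i = (\<Sum>j<r. ?v j * f (unit j) i)"
    by (rule grhom_expand)
  also have "\<dots> = (\<Sum>j<r. hcomp (d - s' i) (v j * f (unit j) i))"
  proof (rule sum.cong[OF refl])
    fix j assume "j \<in> {..<r}"
    then have "f (unit j) \<in> free_component n r' s' (s j)"
      by (intro grhom_component unit_free_component) auto
    then have "homog (s j - s' i) (f (unit j) i)"
      by (simp add: in_free_component)
    from hcomp_mult[OF this, of "d - s' i"]
    show "?v j * f (unit j) i = hcomp (d - s' i) (v j * f (unit j) i)"
      by (simp add: algebra_simps)
  qed
  also have "\<dots> = hcomp (d - s' i) (f v i)"
    by (simp add: grhom_expand[OF v] hcomp_sum)
  finally show "f ?v i = hcomp (d - s' i) (f v i)" .
qed

end

lemma grhom_linear_extension: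
  fixes w :: "nat \<Rightarrow> nat \<Rightarrow> 'k::field mpol"
  assumes "\<And>j. j < r \<Longrightarrow> w j \<in> free_component n r' s' (s j)"
  shows "grhom n r s r' s' (\<lambda>v i. \<Sum>j<r. v j * w j i)"
proof -
  have w: "w j i \<in> carrier (polyR n)" "homog (s j - s' i) (w j i)" "i \<ge> r' \<Longrightarrow> w j i = 0" if "j < r" for i j
    using assms[OF that] by (auto simp: in_free_component in_vecs)
  have "(\<lambda>i. \<Sum>j<r. v j * w j i) \<in> vecs n r'" if "v \<in> vecs n r" for v
    using that w by (auto simp: in_vecs intro!: polyR_sum polyR_mult sum.neutral)
  moreover have "(\<lambda>i. \<Sum>j<r. v j * w j i) \<in> free_component n r' s' d"
    if "v \<in> free_component n r s d" for v d
  proof -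
    have "homog (d - s' i) (v j * w j i)" if "j < r" for i j
    proof -
      have "homog (d - s j) (v j)"
        using \<open>v \<in> free_component n r s d\<close> by (auto simp: in_free_component)
      from homog_mult[OF this w(2)[OF that, of i]] show ?thesis by simp
    qed
    then show ?thesis
      using calculation that by (auto simp: in_free_component intro!: homog_sum)
  qed
  moreover have "(\<lambda>i. \<Sum>j<r. (u + v) j * w j i) = (\<lambda>i. \<Sum>j<r. u j * w j i) + (\<lambda>i. \<Sum>j<r. v j * w j i)" for u v
    by (simp add: fun_eq_iff distrib_right sum.distrib)
  moreover have "(\<lambda>i. \<Sum>j<r. p * u j * w j i) = (\<lambda>i. p * (\<Sum>j<r. u j * w j i))" for p u
    by (simp add: sum_distrib_left mult.assoc)
  ultimately show ?thesis
    unfolding grhom_iff by blast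
qed

text \<open>Projectivity of graded free modules: choose preimages of the images of the basis vectors
  and extend linearly.\<close>

lemma grhom_lift:
  fixes f g :: "(nat \<Rightarrow> 'k::field mpol) \<Rightarrow> nat \<Rightarrow> 'k mpol"
  assumes f: "grhom n r s r' s' f" and g: "grhom n r'' s'' r' s' g"
    and sub: "f ` vecs n r \<subseteq> g ` vecs n r''"
  shows "\<exists>h. grhom n r s r'' s'' h \<and> (\<forall>v\<in>vecs n r. g (h v) = f v)"
proof -
  have "\<exists>y. y \<in> free_component n r'' s'' (s j) \<and> g y = f (unit j)" if "j < r" for j
  proof -
    have "f (unit j) \<in> g ` vecs n r''"
      using sub unit_vecs[OF that, of n] by blast
    then obtain y where y: "y \<in> vecs n r''" "g y = f (unit j)"
      by auto
    \<comment> \<open>An arbitrary preimage need not be homogeneous. Its component of degree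
      \<open>s j\<close> is still a preimage, because \<open>f (unit j)\<close> is homogeneous of
      that degree.\<close>
    let ?y = "\<lambda>i. hcomp (s j - s'' i) (y i)"
    have "?y \<in> free_component n r'' s'' (s j)"
      using y(1) by (auto simp: in_free_component in_vecs homog_hcomp) (auto simp: hcomp_def restr_polyR)
    moreover have "f (unit j) \<in> free_component n r' s' (s j)"
      by (rule grhom_component[OF f unit_free_component[OF that]])
    then have "g ?y = f (unit j)"
      by (auto simp: grhom_hcomp[OF g y(1)] y(2) in_free_component hcomp_homog)
    ultimately show ?thesis by blast
  qed
  then obtain w where w: "\<And>j. j < r \<Longrightarrow> w j \<in> free_component n r'' s'' (s j)"
      "\<And>j. j < r \<Longrightarrow> g (w j) = f (unit j)"
    by metis
  define h where "h = (\<lambda>v i. \<Sum>j<r. v j * w j i)"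
  have h: "grhom n r s r'' s'' h"
    unfolding h_def using w(1) by (rule grhom_linear_extension)
  have wv: "w j \<in> vecs n r''" if "j < r" for j
    using w(1)[OF that] by (simp add: in_free_component)
  have "g (h v) = f v" if v: "v \<in> vecs n r" for v
  proof
    fix i
    have "g (h v) i = (\<Sum>l<r''. (\<Sum>j<r. v j * w j l) * g (unit l) i)"
      by (subst grhom_expand[OF g grhom_closed[OF h v]]) (simp add: h_def)
    also have "\<dots> = (\<Sum>j<r. v j * (\<Sum>l<r''. w j l * g (unit l) i))"
      by (simp add: sum_distrib_right sum_distrib_left mult.assoc) (rule sum.swap)
    also have "\<dots> = (\<Sum>j<r. v j * g (w j) i)"
      by (intro sum.cong refl) (simp add: grhom_expand[OF g wv])
    also have "\<dots> = f v i"
      by (simp add: w(2) grhom_expand[OF f v])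
    finally show "g (h v) i = f v i" .
  qed
  with h show ?thesis by blast
qed

lemma grhom_compose:
  "grhom n r s r' s' f \<Longrightarrow> grhom n r' s' r'' s'' g \<Longrightarrow> grhom n r s r'' s'' (\<lambda>v. g (f v))"
  by (simp add: grhom_iff)

lemma grhom_plus:
  assumes "grhom n r s r' s' f" "grhom n r s r' s' g"
  shows "grhom n r s r' s' (\<lambda>v. f v + g v)"
  using assms unfolding grhom_iff
  by (auto simp: vecs_add in_free_component homog_add fun_eq_iff algebra_simps)

lemma grhom_neg: "grhom n r s r' s' f \<Longrightarrow> grhom n r s r' s' (\<lambda>v. - f v)"
  unfolding grhom_iff
  by (auto simp: vecs_uminus in_free_component homog_uminus fun_eq_iff algebra_simps)

lemma grhom_minus:
  "grhom n r s r' s' f \<Longrightarrow> grhom n r s r' s' g \<Longrightarrow> grhom n r s r' s' (\<lambda>v. f v - g v)"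
  using grhom_plus[OF _ grhom_neg, of n r s r' s' f g] by simp

lemma grhom_ident: "grhom n r s r s (\<lambda>v. v)"
  by (simp add: grhom_iff)

lemma grhom_null: "grhom n r s r' s' (\<lambda>v. 0)"
  by (auto simp: grhom_iff in_free_component vecs_zero fun_eq_iff)

text \<open>In the mapping cone this moves a resolution of R/L to the degree of the monomial that is
  multiplied in.\<close>

lemma grhom_shift:
  fixes f :: "(nat \<Rightarrow> 'k::field mpol) \<Rightarrow> nat \<Rightarrow> 'k mpol"
  assumes "grhom n r s r' s' f"
  shows "grhom n r (\<lambda>j. s j + c) r' (\<lambda>j. s' j + c) f"
proof -
  have "free_component n r (\<lambda>j. s j + c) d = (free_component n r s (d - c) :: (nat \<Rightarrow> 'k mpol) set)"
    for d r and s :: "nat \<Rightarrow> int" by (auto simp: in_free_component algebra_simps)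
  then show ?thesis using assms by (auto simp: grhom_iff)
qed


section \<open>Exact complexes of graded free modules\<close>

text \<open>A resolution of an ideal \<open>J\<close> is handled as a complex whose position 0 is the ring itself,
  placed in \<open>vecs n 1\<close>, and whose first map has image \<open>J\<close>. Thus position \<open>i + 1\<close> here is
  position \<open>i\<close> of the resolution.\<close>

definition gr_exact :: "nat \<Rightarrow> (nat \<Rightarrow> nat) \<Rightarrow> (nat \<Rightarrow> nat \<Rightarrow> int) \<Rightarrow>
    (nat \<Rightarrow> (nat \<Rightarrow> 'k::field mpol) \<Rightarrow> nat \<Rightarrow> 'k mpol) \<Rightarrow> bool" where
  "gr_exact n \<rho> \<sigma> f \<longleftrightarrow>
     (\<forall>i. grhom n (\<rho> (Suc i)) (\<sigma> (Suc i)) (\<rho> i) (\<sigma> i) (f i)) \<and>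
     (\<forall>i. {v \<in> vecs n (\<rho> (Suc i)). f i v = 0} = f (Suc i) ` vecs n (\<rho> (Suc (Suc i))))"

definition resolves :: "nat \<Rightarrow> 'k::field mpol set \<Rightarrow> (nat \<Rightarrow> nat) \<Rightarrow> (nat \<Rightarrow> nat \<Rightarrow> int) \<Rightarrow>
    (nat \<Rightarrow> (nat \<Rightarrow> 'k mpol) \<Rightarrow> nat \<Rightarrow> 'k mpol) \<Rightarrow> bool" where
  "resolves n J \<rho> \<sigma> f \<longleftrightarrow> gr_exact n \<rho> \<sigma> f \<and> \<rho> 0 = 1 \<and> \<sigma> 0 = (\<lambda>_. 0) \<and>
     f 0 ` vecs n (\<rho> 1) = {v \<in> vecs n 1. v 0 \<in> J}"

lemma gr_exact_grhom:
  "gr_exact n \<rho> \<sigma> f \<Longrightarrow> grhom n (\<rho> (Suc i)) (\<sigma> (Suc i)) (\<rho> i) (\<sigma> i) (f i)"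
  by (simp add: gr_exact_def)

lemma gr_exact_closed:
  "gr_exact n \<rho> \<sigma> f \<Longrightarrow> v \<in> vecs n (\<rho> (Suc i)) \<Longrightarrow> f i v \<in> vecs n (\<rho> i)"
  by (rule grhom_closed[OF gr_exact_grhom])

lemma gr_exact_compose:
  "gr_exact n \<rho> \<sigma> f \<Longrightarrow> v \<in> vecs n (\<rho> (Suc (Suc i))) \<Longrightarrow> f i (f (Suc i) v) = 0"
  by (auto simp: gr_exact_def set_eq_iff image_iff)

lemma gr_exact_kernel:
  "gr_exact n \<rho> \<sigma> f \<Longrightarrow> v \<in> vecs n (\<rho> (Suc i)) \<Longrightarrow> f i v = 0 \<Longrightarrow>
     v \<in> f (Suc i) ` vecs n (\<rho> (Suc (Suc i)))"
  by (auto simp: gr_exact_def set_eq_iff)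

text \<open>The comparison theorem: \<open>h i\<close> composed with \<open>g i\<close> lands in the
  image of \<open>f i\<close>, so freeness lets it be lifted to \<open>h (Suc i)\<close>; exactness
  of \<open>f\<close> then makes the next step possible.\<close>

lemma comparison_maps:
  fixes f g :: "nat \<Rightarrow> (nat \<Rightarrow> 'k::field mpol) \<Rightarrow> nat \<Rightarrow> 'k mpol"
  assumes f: "gr_exact n \<rho> \<sigma> f" and g: "gr_exact n \<kappa> \<tau> g"
    and h0: "grhom n (\<kappa> 0) (\<tau> 0) (\<rho> 0) (\<sigma> 0) h0"
    and im: "\<And>v. v \<in> vecs n (\<kappa> 1) \<Longrightarrow> h0 (g 0 v) \<in> f 0 ` vecs n (\<rho> 1)"
  shows "\<exists>h. h 0 = h0 \<and> (\<forall>i. grhom n (\<kappa> i) (\<tau> i) (\<rho> i) (\<sigma> i) (h i)) \<and>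
    (\<forall>i. \<forall>v\<in>vecs n (\<kappa> (Suc i)). f i (h (Suc i) v) = h i (g i v))"
proof -
  \<comment> \<open>Dependent choice sees only the previous map, so the invariant carries the fact
    that the next lift exists.\<close>
  let ?P = "\<lambda>i h. grhom n (\<kappa> i) (\<tau> i) (\<rho> i) (\<sigma> i) h \<and>
    (\<forall>v\<in>vecs n (\<kappa> (Suc i)). h (g i v) \<in> f i ` vecs n (\<rho> (Suc i))) \<and> (i = 0 \<longrightarrow> h = h0)"
  let ?Q = "\<lambda>i h h'. \<forall>v\<in>vecs n (\<kappa> (Suc i)). f i (h' v) = h (g i v)"
  have start: "\<exists>h. ?P 0 h"
    using h0 im by auto
  have step: "\<exists>h'. ?P (Suc i) h' \<and> ?Q i h h'" if P: "?P i h" for i h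
  proof -
    have hg: "grhom n (\<kappa> (Suc i)) (\<tau> (Suc i)) (\<rho> i) (\<sigma> i) (\<lambda>v. h (g i v))"
      using P by (intro grhom_compose[OF gr_exact_grhom[OF g]]) simp
    have "(\<lambda>v. h (g i v)) ` vecs n (\<kappa> (Suc i)) \<subseteq> f i ` vecs n (\<rho> (Suc i))"
      using P by blast
    from grhom_lift[OF hg gr_exact_grhom[OF f] this] obtain h'
      where h': "grhom n (\<kappa> (Suc i)) (\<tau> (Suc i)) (\<rho> (Suc i)) (\<sigma> (Suc i)) h'" "?Q i h h'"
      by blast
    have "h' (g (Suc i) v) \<in> f (Suc i) ` vecs n (\<rho> (Suc (Suc i)))" if v: "v \<in> vecs n (\<kappa> (Suc (Suc i)))" for v
    proof (rule gr_exact_kernel[OF f])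
      have gv: "g (Suc i) v \<in> vecs n (\<kappa> (Suc i))"
        by (rule gr_exact_closed[OF g v])
      show "h' (g (Suc i) v) \<in> vecs n (\<rho> (Suc i))"
        by (rule grhom_closed[OF h'(1) gv])
      have "f i (h' (g (Suc i) v)) = h (g i (g (Suc i) v))"
        using h'(2) gv by blast
      also have "\<dots> = 0"
        using P by (auto simp: gr_exact_compose[OF g v] intro: grhom_zero)
      finally show "f i (h' (g (Suc i) v)) = 0" .
    qed
    with h' show ?thesis by blast
  qed
  have "\<exists>h. \<forall>i. ?P i (h i) \<and> ?Q i (h i) (h (Suc i))"
    by (rule dependent_nat_choice[of ?P ?Q, OF start step])
  then obtain h where h: "\<forall>i. ?P i (h i) \<and> ?Q i (h i) (h (Suc i))" ..
  then have "h 0 = h0" by simp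
  with h show ?thesis by metis
qed

text \<open>A chain map that vanishes in position 0 is null-homotopic:
  \<open>\<theta> (Suc i)\<close> minus the part already accounted for by \<open>h i\<close> takes
  values in the kernel of \<open>f i\<close>, hence lifts through \<open>f (Suc i)\<close>.\<close>

lemma null_homotopy:
  fixes f \<theta> :: "nat \<Rightarrow> (nat \<Rightarrow> 'k::field mpol) \<Rightarrow> nat \<Rightarrow> 'k mpol"
  assumes f: "gr_exact n \<rho> \<sigma> f"
    and \<theta>: "\<And>i. grhom n (\<rho> i) (\<sigma> i) (\<rho> i) (\<sigma> i) (\<theta> i)"
    and comm: "\<And>i v. v \<in> vecs n (\<rho> (Suc i)) \<Longrightarrow> f i (\<theta> (Suc i) v) = \<theta> i (f i v)"
    and \<theta>0: "\<And>v. v \<in> vecs n (\<rho> 0) \<Longrightarrow> \<theta> 0 v = 0"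
  shows "\<exists>h. h 0 = (\<lambda>_. 0) \<and> (\<forall>i. grhom n (\<rho> i) (\<sigma> i) (\<rho> (Suc i)) (\<sigma> (Suc i)) (h i)) \<and>
    (\<forall>i. \<forall>v\<in>vecs n (\<rho> (Suc i)). \<theta> (Suc i) v = f (Suc i) (h (Suc i) v) + h i (f i v))"
proof -
  let ?P = "\<lambda>i h. grhom n (\<rho> i) (\<sigma> i) (\<rho> (Suc i)) (\<sigma> (Suc i)) h \<and>
    (\<forall>v\<in>vecs n (\<rho> (Suc i)). f i (\<theta> (Suc i) v - h (f i v)) = 0) \<and> (i = 0 \<longrightarrow> h = (\<lambda>_. 0))"
  let ?Q = "\<lambda>i h h'. \<forall>v\<in>vecs n (\<rho> (Suc i)). f (Suc i) (h' v) = \<theta> (Suc i) v - h (f i v)"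
  have "?P 0 (\<lambda>_. 0)"
    using comm \<theta>0 gr_exact_closed[OF f] by (auto simp: grhom_null)
  then have start: "\<exists>h. ?P 0 h" by blast
  have step: "\<exists>h'. ?P (Suc i) h' \<and> ?Q i h h'" if P: "?P i h" for i h
  proof -
    let ?d = "\<lambda>v. \<theta> (Suc i) v - h (f i v)"
    have d: "grhom n (\<rho> (Suc i)) (\<sigma> (Suc i)) (\<rho> (Suc i)) (\<sigma> (Suc i)) ?d"
      using P by (intro grhom_minus \<theta> grhom_compose[OF gr_exact_grhom[OF f]]) simp
    have "?d ` vecs n (\<rho> (Suc i)) \<subseteq> f (Suc i) ` vecs n (\<rho> (Suc (Suc i)))"
      using P by (auto intro!: gr_exact_kernel[OF f] grhom_closed[OF d])
    from grhom_lift[OF d gr_exact_grhom[OF f] this] obtain h'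
      where h': "grhom n (\<rho> (Suc i)) (\<sigma> (Suc i)) (\<rho> (Suc (Suc i))) (\<sigma> (Suc (Suc i))) h'" "?Q i h h'"
      by blast
    have "f (Suc i) (\<theta> (Suc (Suc i)) v - h' (f (Suc i) v)) = 0"
      if v: "v \<in> vecs n (\<rho> (Suc (Suc i)))" for v
    proof -
      have fv: "f (Suc i) v \<in> vecs n (\<rho> (Suc i))"
        by (rule gr_exact_closed[OF f v])
      have "f (Suc i) (\<theta> (Suc (Suc i)) v - h' (f (Suc i) v)) =
          \<theta> (Suc i) (f (Suc i) v) - f (Suc i) (h' (f (Suc i) v))"
        by (subst grhom_diff[OF gr_exact_grhom[OF f]])
          (auto intro: grhom_closed[OF \<theta>] grhom_closed[OF h'(1)] v fv simp: comm v)
      also have "\<dots> = h (f i (f (Suc i) v))"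
        using h'(2) fv by simp
      also have "\<dots> = 0"
        using P by (auto simp: gr_exact_compose[OF f v] intro: grhom_zero)
      finally show ?thesis .
    qed
    with h' show ?thesis by blast
  qed
  have "\<exists>h. \<forall>i. ?P i (h i) \<and> ?Q i (h i) (h (Suc i))"
    by (rule dependent_nat_choice[of ?P ?Q, OF start step])
  then obtain h where h: "\<forall>i. ?P i (h i) \<and> ?Q i (h i) (h (Suc i))" ..
  have "\<theta> (Suc i) v = f (Suc i) (h (Suc i) v) + h i (f i v)" if "v \<in> vecs n (\<rho> (Suc i))" for i v
    using h that by simp
  moreover have "h 0 = (\<lambda>_. 0)"
    using h by simp
  ultimately show ?thesis using h by metis
qed

section \<open>Uniqueness of the ranks\<close>

text \<open>If an r by s matrix times an s by r matrix is the identity, the r rows of the identity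
  are independent and lie in the span of the s rows of \<open>B\<close>.\<close>

lemma rank_le:
  fixes r s :: nat and A B :: "nat \<Rightarrow> nat \<Rightarrow> 'k::field"
  assumes AB: "\<And>i j. i < r \<Longrightarrow> j < r \<Longrightarrow> (\<Sum>l<s. A i l * B l j) = (if i = j then 1 else 0)"
  shows "r \<le> s"
proof -
  interpret V: vector_space "\<lambda>(c::'k) v. (\<lambda>j::nat. c * v j)"
    by unfold_locales (auto simp: fun_eq_iff algebra_simps)
  \<comment> \<open>The ambient space consists of functions on all of nat, so the rows of
    \<open>B\<close> are cut off at \<open>r\<close>.\<close>
  define b :: "nat \<Rightarrow> nat \<Rightarrow> 'k" where "b = (\<lambda>l j. if j < r then B l j else 0)"
  define u :: "nat \<Rightarrow> nat \<Rightarrow> 'k" where "u = (\<lambda>i j. if j = i then 1 else 0)"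
  have sum_apply: "(\<Sum>x\<in>X. F x) j = (\<Sum>x\<in>X. F x j)" for X :: "'a set" and F :: "'a \<Rightarrow> nat \<Rightarrow> 'k" and j
    by (induction X rule: infinite_finite_induct) auto
  have inj: "inj_on u {..<r}"
    by (auto simp: inj_on_def u_def fun_eq_iff split: if_splits)
  have "u ` {..<r} \<subseteq> V.span (b ` {..<s})"
  proof (rule image_subsetI)
    fix i assume "i \<in> {..<r}"
    then have "u i j = (\<Sum>l<s. A i l * b l j)" for j
      using AB[of i j] by (cases "j < r") (auto simp: u_def b_def)
    then have "u i = (\<Sum>l<s. (\<lambda>j. A i l * b l j))"
      by (simp add: fun_eq_iff sum_apply)
    moreover have "(\<lambda>j. A i l * b l j) \<in> V.span (b ` {..<s})" if "l < s" for l
      using that by (intro V.span_scale[of "b l"] V.span_base) simp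
    then have "(\<Sum>l<s. (\<lambda>j. A i l * b l j)) \<in> V.span (b ` {..<s})"
      by (intro V.span_sum) simp
    ultimately show "u i \<in> V.span (b ` {..<s})"
      by simp
  qed
  moreover have "\<not> V.dependent (u ` {..<r})"
  proof (rule V.independent_if_scalars_zero)
    show "finite (u ` {..<r})" by simp
    fix c x assume 0: "(\<Sum>x\<in>u ` {..<r}. (\<lambda>j. c x * x j)) = 0" and "x \<in> u ` {..<r}"
    then obtain i where i: "i < r" "x = u i" by auto
    have "0 = (\<Sum>x\<in>u ` {..<r}. (\<lambda>j. c x * x j)) i"
      by (simp add: 0)
    also have "\<dots> = (\<Sum>l<r. c (u l) * u l i)"
      by (simp add: sum_apply sum.reindex[OF inj])
    also have "\<dots> = (\<Sum>l<r. if l = i then c (u l) else 0)"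
      by (intro sum.cong) (auto simp: u_def)
    also have "\<dots> = c x"
      using i by simp
    finally show "c x = 0" by simp
  qed
  ultimately have "card (u ` {..<r}) \<le> card (b ` {..<s})"
    using V.independent_span_bound[of "b ` {..<s}" "u ` {..<r}"] by simp
  also have "\<dots> \<le> s"
    using card_image_le[of "{..<s}" b] by simp
  finally show ?thesis
    by (simp add: card_image[OF inj])
qed

text \<open>The composite of the comparison maps in both directions is homotopic to the identity, and
  by minimality the homotopy vanishes modulo the variables.\<close>

lemma resolves_rank_le:
  fixes f g :: "nat \<Rightarrow> (nat \<Rightarrow> 'k::field mpol) \<Rightarrow> nat \<Rightarrow> 'k mpol"
  assumes f: "resolves n J \<rho> \<sigma> f" and g: "resolves n J \<kappa> \<tau> g"
    and min: "\<And>i v j. v \<in> vecs n (\<rho> (Suc (Suc i))) \<Longrightarrow> Poly_Mapping.lookup (f (Suc i) v j) 0 = 0"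
  shows "\<rho> (Suc i) \<le> \<kappa> (Suc i)"
proof -
  note fe = f[unfolded resolves_def, THEN conjunct1] and ge = g[unfolded resolves_def, THEN conjunct1]
  have f0: "\<rho> 0 = 1" "\<sigma> 0 = (\<lambda>_. 0)" "f 0 ` vecs n (\<rho> 1) = {v \<in> vecs n 1. v 0 \<in> J}"
    using f by (auto simp: resolves_def)
  have g0: "\<kappa> 0 = 1" "\<tau> 0 = (\<lambda>_. 0)" "g 0 ` vecs n (\<kappa> 1) = {v \<in> vecs n 1. v 0 \<in> J}"
    using g by (auto simp: resolves_def)
  have hom: "grhom n (\<rho> 0) (\<sigma> 0) (\<kappa> 0) (\<tau> 0) (\<lambda>v :: nat \<Rightarrow> 'k mpol. v)"
      "grhom n (\<kappa> 0) (\<tau> 0) (\<rho> 0) (\<sigma> 0) (\<lambda>v :: nat \<Rightarrow> 'k mpol. v)"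
    by (simp_all add: f0 g0 grhom_ident)
  have im: "v \<in> vecs n (\<rho> 1) \<Longrightarrow> f 0 v \<in> g 0 ` vecs n (\<kappa> 1)"
      "v \<in> vecs n (\<kappa> 1) \<Longrightarrow> g 0 v \<in> f 0 ` vecs n (\<rho> 1)" for v
    using f0(3) g0(3) by blast+
  obtain \<phi> where \<phi>: "\<phi> 0 = (\<lambda>v. v)" "\<And>i. grhom n (\<rho> i) (\<sigma> i) (\<kappa> i) (\<tau> i) (\<phi> i)"
      "\<And>i v. v \<in> vecs n (\<rho> (Suc i)) \<Longrightarrow> g i (\<phi> (Suc i) v) = \<phi> i (f i v)"
    using comparison_maps[OF ge fe hom(1) im(1)] by blast
  obtain \<psi> where \<psi>: "\<psi> 0 = (\<lambda>v. v)" "\<And>i. grhom n (\<kappa> i) (\<tau> i) (\<rho> i) (\<sigma> i) (\<psi> i)"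
      "\<And>i v. v \<in> vecs n (\<kappa> (Suc i)) \<Longrightarrow> f i (\<psi> (Suc i) v) = \<psi> i (g i v)"
    using comparison_maps[OF fe ge hom(2) im(2)] by blast
  define \<theta> where "\<theta> = (\<lambda>i v. \<psi> i (\<phi> i v) - v)"
  have "\<exists>h. h 0 = (\<lambda>_. 0) \<and> (\<forall>i. grhom n (\<rho> i) (\<sigma> i) (\<rho> (Suc i)) (\<sigma> (Suc i)) (h i)) \<and>
    (\<forall>i. \<forall>v\<in>vecs n (\<rho> (Suc i)). \<theta> (Suc i) v = f (Suc i) (h (Suc i) v) + h i (f i v))"
  proof (rule null_homotopy[OF fe])
    show "grhom n (\<rho> i) (\<sigma> i) (\<rho> i) (\<sigma> i) (\<theta> i)" for i
      unfolding \<theta>_def by (rule grhom_minus[OF grhom_compose[OF \<phi>(2) \<psi>(2)] grhom_ident])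
    show "f i (\<theta> (Suc i) v) = \<theta> i (f i v)" if v: "v \<in> vecs n (\<rho> (Suc i))" for i v
      unfolding \<theta>_def
      by (subst grhom_diff[OF gr_exact_grhom[OF fe]])
        (auto simp: \<phi>(3) \<psi>(3) v grhom_closed[OF \<phi>(2)] intro!: grhom_closed[OF \<psi>(2)] grhom_closed[OF \<phi>(2)])
  qed (simp add: \<theta>_def \<phi>(1) \<psi>(1) fun_eq_iff)
  then obtain h where h: "h 0 = (\<lambda>_. 0)" "\<And>i. grhom n (\<rho> i) (\<sigma> i) (\<rho> (Suc i)) (\<sigma> (Suc i)) (h i)"
      "\<And>i v. v \<in> vecs n (\<rho> (Suc i)) \<Longrightarrow> \<theta> (Suc i) v = f (Suc i) (h (Suc i) v) + h i (f i v)"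
    by blast
  have const: "Poly_Mapping.lookup (\<theta> (Suc i) v j) 0 = 0" if v: "v \<in> vecs n (\<rho> (Suc i))" for v j
  proof -
    have "Poly_Mapping.lookup (f (Suc i) (h (Suc i) v) j) 0 = 0"
      by (rule min[OF grhom_closed[OF h(2) v]])
    moreover have "Poly_Mapping.lookup (h i (f i v) j) 0 = 0"
    \<comment> \<open>Minimality says nothing about \<open>f 0\<close>, whose image is
      \<open>J\<close>; in that position the homotopy is zero. Afterwards the coordinates of
      \<open>f i v\<close> have no constant term, and linear maps preserve this.\<close>
    proof (cases i)
      case 0
      then show ?thesis by (simp add: h(1))
    next
      case (Suc i')
      then have "Poly_Mapping.lookup (f i v l) 0 = 0" for l
        using min v by simp
      then show ?thesis
        by (simp add: grhom_expand[OF h(2) gr_exact_closed[OF fe v]] lookup_sum lookup_mult_zero)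
    qed
    ultimately show ?thesis
      by (simp add: h(3)[OF v] lookup_add)
  qed
  \<comment> \<open>The matrices of the two comparison maps modulo the variables. Their product is
    the identity because \<open>\<theta>\<close> has no constant terms.\<close>
  define A where "A = (\<lambda>k l. Poly_Mapping.lookup (\<phi> (Suc i) (unit k) l) 0)"
  define B where "B = (\<lambda>l j. Poly_Mapping.lookup (\<psi> (Suc i) (unit l) j) 0)"
  show ?thesis
  proof (rule rank_le[where A = A and B = B])
    fix k j assume k: "k < \<rho> (Suc i)" and "j < \<rho> (Suc i)"
    have "(\<Sum>l<\<kappa> (Suc i). A k l * B l j) = Poly_Mapping.lookup (\<psi> (Suc i) (\<phi> (Suc i) (unit k)) j) 0"
      by (simp add: grhom_expand[OF \<psi>(2) grhom_closed[OF \<phi>(2) unit_vecs[OF k]]] lookup_sum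
          lookup_mult_zero A_def B_def)
    also have "\<dots> = Poly_Mapping.lookup (unit k j :: 'k mpol) 0"
      using const[OF unit_vecs[OF k], of j] by (simp add: \<theta>_def lookup_minus)
    finally show "(\<Sum>l<\<kappa> (Suc i). A k l * B l j) = (if k = j then 1 else 0)"
      by (auto simp: unit_def)
  qed
qed

section \<open>Minimal free resolutions as complexes that begin with the ring; well-definedness of
  Betti numbers\<close>

lemma free_module_zero: "\<zero>\<^bsub>free_module n r\<^esub> = 0"
  by (simp add: free_module_def zero_fun_def)

text \<open>The augmentation becomes the first map of the complex by placing its value in coordinate
  0 of \<open>vecs n 1\<close>, and all other positions move up by one.\<close>

lemma minimal_resolution_resolves:
  assumes "minimal_graded_free_resolution n (ideal_module J) (ideal_component J) r s d aug"
    and J: "J \<subseteq> carrier (polyR n)"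
  defines "f \<equiv> case_nat (\<lambda>v j. if j = 0 then aug v else 0) d"
  shows "resolves n J (case_nat 1 r) (case_nat (\<lambda>_. 0) s) f"
    and "v \<in> vecs n (case_nat 1 r (Suc (Suc i))) \<Longrightarrow> Poly_Mapping.lookup (f (Suc i) v j) 0 = 0"
proof -
  have aug: "\<And>u. u \<in> vecs n (r 0) \<Longrightarrow> aug u \<in> J"
    "\<And>u v. u \<in> vecs n (r 0) \<Longrightarrow> v \<in> vecs n (r 0) \<Longrightarrow> aug (u + v) = aug u + aug v"
    "\<And>p u. p \<in> carrier (polyR n) \<Longrightarrow> u \<in> vecs n (r 0) \<Longrightarrow> aug (\<lambda>j. p * u j) = p * aug u"
    "\<And>e v. v \<in> free_component n (r 0) (s 0) e \<Longrightarrow> homog e (aug v)"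
    "aug ` vecs n (r 0) = J"
    "{u \<in> vecs n (r 0). aug u = 0} = d 0 ` vecs n (r 1)"
    using assms(1)
    by (auto simp: minimal_graded_free_resolution_def Let_def mod_hom_def mod_ker_def ideal_module_def
        ideal_component_def free_module_def plus_fun_def image_subset_iff)
  have d: "\<And>i. grhom n (r (Suc i)) (s (Suc i)) (r i) (s i) (d i)"
    "\<And>i. {u \<in> vecs n (r (Suc i)). d i u = 0} = d (Suc i) ` vecs n (r (Suc (Suc i)))"
    "\<And>i j v. v \<in> vecs n (r (Suc i)) \<Longrightarrow> j < r i \<Longrightarrow> Poly_Mapping.lookup (d i v j) 0 = 0"
    using assms(1)
    by (simp_all add: minimal_graded_free_resolution_def Let_def grhom_def mod_ker_def free_module_zero)
  have "grhom n (r 0) (s 0) 1 (\<lambda>_. 0) (f 0)"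
    using aug(1-4) J unfolding grhom_iff
    by (auto simp: f_def in_vecs in_free_component fun_eq_iff polyR_zero)
  moreover have "{v \<in> vecs n (r 0). f 0 v = 0} = d 0 ` vecs n (r 1)"
    unfolding aug(6)[symmetric] by (auto simp: f_def fun_eq_iff)
  moreover have "f 0 ` vecs n (r 0) = {v \<in> vecs n 1. v 0 \<in> J}"
  proof (intro equalityI subsetI)
    fix v assume "v \<in> f 0 ` vecs n (r 0)"
    then obtain u where "aug u \<in> J" "v = f 0 u"
      using aug(1) by blast
    then show "v \<in> {v \<in> vecs n 1. v 0 \<in> J}"
      using J by (auto simp: f_def in_vecs polyR_zero)
  next
    fix v assume "v \<in> {v \<in> vecs n 1. v 0 \<in> J}"
    then have v: "v \<in> vecs n 1" "v 0 \<in> aug ` vecs n (r 0)" using aug(5) by auto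
    then obtain u where "u \<in> vecs n (r 0)" "v 0 = aug u" by auto
    moreover from this v(1) have "v = f 0 u" by (auto simp: f_def in_vecs fun_eq_iff)
    ultimately show "v \<in> f 0 ` vecs n (r 0)" by blast
  qed
  ultimately show "resolves n J (case_nat 1 r) (case_nat (\<lambda>_. 0) s) f"
    using d(1,2) by (auto simp: resolves_def gr_exact_def f_def split: nat.split)
  show "Poly_Mapping.lookup (f (Suc i) v j) 0 = 0" if "v \<in> vecs n (case_nat 1 r (Suc (Suc i)))"
  proof (cases "j < r i")
    case True
    then show ?thesis using d(3) that by (simp add: f_def)
  next
    case False
    then show ?thesis using vecsD(2)[OF grhom_closed[OF d(1)]] that by (simp add: f_def)
  qed
qed

lemma resolves_minimal_resolution:
  assumes f: "resolves n J \<rho> \<sigma> f"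
    and min: "\<And>i v j. v \<in> vecs n (\<rho> (Suc (Suc i))) \<Longrightarrow> Poly_Mapping.lookup (f (Suc i) v j) 0 = 0"
    and J: "J \<subseteq> carrier (polyR n)"
  shows "minimal_graded_free_resolution n (ideal_module J) (ideal_component J)
    (\<lambda>i. \<rho> (Suc i)) (\<lambda>i. \<sigma> (Suc i)) (\<lambda>i. f (Suc i)) (\<lambda>v. f 0 v 0)"
proof -
  note fe = f[unfolded resolves_def, THEN conjunct1]
  note hom = gr_exact_grhom[OF fe]
  have f0: "\<rho> 0 = 1" "\<sigma> 0 = (\<lambda>_. 0)" "f 0 ` vecs n (\<rho> 1) = {v \<in> vecs n 1. v 0 \<in> J}"
    using f by (auto simp: resolves_def)
  have hom0: "grhom n (\<rho> 1) (\<sigma> 1) 1 (\<lambda>_. 0) (f 0)"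
    using hom[of 0] f0 by simp
  have inJ: "f 0 v 0 \<in> J" if "v \<in> vecs n (\<rho> 1)" for v
    using f0(3) that by blast
  have im: "(\<lambda>v. f 0 v 0) ` vecs n (\<rho> 1) = J"
  proof (intro equalityI subsetI)
    fix p assume p: "p \<in> J"
    then have "(\<lambda>j. if j = 0 then p else 0) \<in> {v \<in> vecs n 1. v 0 \<in> J}"
      using J by (auto simp: in_vecs polyR_zero)
    then have "(\<lambda>j. if j = 0 then p else 0) \<in> f 0 ` vecs n (\<rho> 1)"
      unfolding f0(3) .
    then obtain v where "v \<in> vecs n (\<rho> 1)" "f 0 v = (\<lambda>j. if j = 0 then p else 0)"
      by auto
    then show "p \<in> (\<lambda>v. f 0 v 0) ` vecs n (\<rho> 1)"
      by (auto intro!: image_eqI[of _ _ v])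
  qed (use inJ in auto)
  have "f 0 v = 0 \<longleftrightarrow> f 0 v 0 = 0" if "v \<in> vecs n (\<rho> 1)" for v
    using vecsD(2)[OF grhom_closed[OF hom0 that]] by (auto simp: fun_eq_iff Suc_le_eq)
      (metis gr0I)
  then have "{v \<in> vecs n (\<rho> 1). f 0 v 0 = 0} = {v \<in> vecs n (\<rho> 1). f 0 v = 0}"
    by blast
  also have "\<dots> = f 1 ` vecs n (\<rho> 2)"
    using fe[unfolded gr_exact_def, THEN conjunct2, THEN spec, of 0] by (simp add: numeral_2_eq_2)
  finally have ker0: "{v \<in> vecs n (\<rho> 1). f 0 v 0 = 0} = f 1 ` vecs n (\<rho> 2)" .
  have "mod_hom (polyR n) (free_module n (\<rho> 1)) (ideal_module J) (\<lambda>v. f 0 v 0)"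
    using inJ grhom_add[OF hom0] grhom_scale[OF hom0]
    by (auto simp: mod_hom_def free_module_def ideal_module_def plus_fun_def)
  moreover have "(\<lambda>v. f 0 v 0) ` free_component n (\<rho> 1) (\<sigma> 1) e \<subseteq> ideal_component J e" for e
    using grhom_component[OF hom0] inJ by (auto simp: ideal_component_def in_free_component)
  moreover have "mod_ker (free_module n (\<rho> (Suc (Suc i)))) (free_module n (\<rho> (Suc i))) (f (Suc i)) =
      f (Suc (Suc i)) ` vecs n (\<rho> (Suc (Suc (Suc i))))" for i
    using fe by (simp add: gr_exact_def mod_ker_def free_module_zero)
  moreover have "mod_ker (free_module n (\<rho> 1)) (ideal_module J) (\<lambda>v. f 0 v 0) = f 1 ` vecs n (\<rho> 2)"
    unfolding ker0[symmetric] by (auto simp: mod_ker_def ideal_module_def)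
  moreover have "carrier (ideal_module J) = J"
    by (simp add: ideal_module_def)
  ultimately show ?thesis
    using hom[of "Suc _"] im min
    by (auto simp: minimal_graded_free_resolution_def Let_def grhom_def numeral_2_eq_2)
qed

text \<open>The rank inequality applies in both directions between the given complex and any
  competitor, as both are minimal; this determines the definite description in
  \<open>betti\<close>.\<close>

lemma betti_ideal_eq:
  fixes J :: "'k::field mpol set"
  assumes f: "resolves n J \<rho> \<sigma> f"
    and min: "\<And>i v j. v \<in> vecs n (\<rho> (Suc (Suc i))) \<Longrightarrow> Poly_Mapping.lookup (f (Suc i) v j) 0 = 0"
    and J: "J \<subseteq> carrier (polyR n)"
  shows "betti_ideal n J i = \<rho> (Suc i)"
  unfolding betti_def
proof (rule the_equality)
  show "\<exists>r s d aug. minimal_graded_free_resolution n (ideal_module J) (ideal_component J) r s d aug \<and> \<rho> (Suc i) = r i"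
    using resolves_minimal_resolution[OF f min J] by blast
next
  fix b assume "\<exists>r s d aug. minimal_graded_free_resolution n (ideal_module J) (ideal_component J) r s d aug \<and> b = r i"
  then obtain r s d aug
    where res: "minimal_graded_free_resolution n (ideal_module J) (ideal_component J) r s d aug"
      and b: "b = r i" by blast
  note g = minimal_resolution_resolves[OF res J]
  show "b = \<rho> (Suc i)"
    using resolves_rank_le[OF f g(1) min, of i] resolves_rank_le[OF g(1) f g(2), of i] b by simp
qed


section \<open>Mapping cones of linear resolutions\<close>

text \<open>The direct sum of free modules of ranks \<open>r\<close> and \<open>k\<close> is
  modelled by concatenating coordinates; \<open>vtake\<close> and \<open>vdrop\<close> are its
  projections and \<open>vappend\<close> is the pairing.\<close>

definition vtake :: "nat \<Rightarrow> (nat \<Rightarrow> 'k::field mpol) \<Rightarrow> nat \<Rightarrow> 'k mpol" where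
  "vtake r v = (\<lambda>j. if j < r then v j else 0)"

definition vdrop :: "nat \<Rightarrow> (nat \<Rightarrow> 'k::field mpol) \<Rightarrow> nat \<Rightarrow> 'k mpol" where
  "vdrop r v = (\<lambda>j. v (j + r))"

definition vappend :: "nat \<Rightarrow> (nat \<Rightarrow> 'k::field mpol) \<Rightarrow> (nat \<Rightarrow> 'k mpol) \<Rightarrow> nat \<Rightarrow> 'k mpol" where
  "vappend r u w = (\<lambda>j. if j < r then u j else w (j - r))"

lemma vappend_vtake_vdrop [simp]: "vappend r (vtake r v) (vdrop r v) = v"
  by (auto simp: vappend_def vtake_def vdrop_def)

lemma vtake_vappend: "u \<in> vecs n r \<Longrightarrow> vtake r (vappend r u w) = u"
  by (auto simp: vappend_def vtake_def in_vecs fun_eq_iff)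

lemma vdrop_vappend: "vdrop r (vappend r u w) = w"
  by (auto simp: vappend_def vdrop_def)

lemma vtake_vecs: "v \<in> vecs n (r + k) \<Longrightarrow> vtake r v \<in> vecs n r"
  by (auto simp: in_vecs vtake_def polyR_zero)

lemma vdrop_vecs: "v \<in> vecs n (r + k) \<Longrightarrow> vdrop r v \<in> vecs n k"
  by (auto simp: in_vecs vdrop_def)

lemma vappend_vecs: "u \<in> vecs n r \<Longrightarrow> w \<in> vecs n k \<Longrightarrow> vappend r u w \<in> vecs n (r + k)"
  by (auto simp: in_vecs vappend_def)

lemma vappend_eq_0_iff: "u \<in> vecs n r \<Longrightarrow> vappend r u w = 0 \<longleftrightarrow> u = 0 \<and> w = 0"
proof
  assume u: "u \<in> vecs n r" and z: "vappend r u w = 0"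
  have "u = vtake r 0" "w = vdrop r 0"
    using vtake_vappend[OF u, of w] vdrop_vappend[of r u w] by (simp_all add: z)
  then show "u = 0 \<and> w = 0"
    by (auto simp: vtake_def vdrop_def fun_eq_iff)
qed (auto simp: vappend_def fun_eq_iff)

lemma grhom_vtake: "grhom n (r + k) (\<lambda>_. c) r (\<lambda>_. c) (vtake r)"
  unfolding grhom_iff
  by (auto simp: vtake_vecs in_free_component) (auto simp: vtake_def fun_eq_iff)

lemma grhom_vdrop: "grhom n (r + k) (\<lambda>_. c) k (\<lambda>_. c) (vdrop r)"
  unfolding grhom_iff
  by (auto simp: vdrop_vecs in_free_component) (auto simp: vdrop_def fun_eq_iff)

lemma grhom_vappend:
  fixes f g :: "(nat \<Rightarrow> 'a::field mpol) \<Rightarrow> nat \<Rightarrow> 'a mpol"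
  assumes "grhom n r0 s0 r (\<lambda>_. c) f" "grhom n r0 s0 k (\<lambda>_. c) g"
  shows "grhom n r0 s0 (r + k) (\<lambda>_. c) (\<lambda>v. vappend r (f v) (g v))"
proof -
  have "vappend r (f u) (g u) \<in> free_component n (r + k) (\<lambda>_. c) d" if "u \<in> free_component n r0 s0 d" for u d
    using grhom_component[OF assms(1) that] grhom_component[OF assms(2) that]
    by (auto simp: in_free_component vappend_vecs) (auto simp: vappend_def)
  moreover have "vappend r (u + u') (w + w') = vappend r u w + vappend r u' w'"
      "vappend r (\<lambda>j. p * u j) (\<lambda>j. p * w j) = (\<lambda>j. p * vappend r u w j)"
    for p :: "'a mpol" and u u' w w'
    by (auto simp: vappend_def fun_eq_iff)
  ultimately show ?thesis
    unfolding grhom_iff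
    using grhom_closed[OF assms(1)] grhom_closed[OF assms(2)]
    by (simp add: vappend_vecs grhom_add[OF assms(1)] grhom_add[OF assms(2)]
        grhom_scale[OF assms(1)] grhom_scale[OF assms(2)])
qed

text \<open>Position 0 is the ring, generated in degree 0. Position 1 holds the generators of an
  ideal in degree \<open>d\<close>, and each further position is one degree higher.\<close>

definition lin_shift :: "int \<Rightarrow> nat \<Rightarrow> nat \<Rightarrow> int" where
  "lin_shift d i = (\<lambda>_. if i = 0 then 0 else d + int i - 1)"

definition lin_res :: "nat \<Rightarrow> int \<Rightarrow> 'k::field mpol set \<Rightarrow> (nat \<Rightarrow> nat) \<Rightarrow> bool" where
  "lin_res n d J \<rho> \<longleftrightarrow> (\<exists>f. resolves n J \<rho> (lin_shift d) f)"

text \<open>Past the first map all matrix entries are linear forms, so they have no constant term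
  and minimality is automatic.\<close>

lemma lin_res_betti:
  assumes "lin_res n d J \<rho>" and J: "J \<subseteq> carrier (polyR n)"
  shows "betti_ideal n J i = \<rho> (Suc i)"
proof -
  obtain f where f: "resolves n J \<rho> (lin_shift d) f"
    using assms(1) by (auto simp: lin_res_def)
  then have hom: "grhom n (\<rho> (Suc i)) (lin_shift d (Suc i)) (\<rho> i) (lin_shift d i) (f i)" for i
    by (simp add: resolves_def gr_exact_def)
  have "Poly_Mapping.lookup (f (Suc i) v j) 0 = 0" if v: "v \<in> vecs n (\<rho> (Suc (Suc i)))" for i v j
  proof -
    have "Poly_Mapping.lookup (f (Suc i) (unit l) j) 0 = 0" if "l < \<rho> (Suc (Suc i))" for l
    proof -
      have "homog 1 (f (Suc i) (unit l) j)"
        using grhom_component[OF hom unit_free_component[OF that]]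
        by (auto simp: in_free_component lin_shift_def)
      then show ?thesis by (rule homog_lookup_zero) simp
    qed
    then show ?thesis
      by (simp add: grhom_expand[OF hom v] lookup_sum lookup_mult_zero)
  qed
  from betti_ideal_eq[OF f this J] show ?thesis .
qed

text \<open>The cone over the comparison map \<open>\<alpha>\<close> that lifts multiplication by \<open>m\<close> from a resolution
  of \<open>R/L\<close>, where \<open>L\<close> is the colon ideal of \<open>J\<close> by \<open>m\<close>, to a resolution of \<open>R/J\<close>. All degrees
  being linear, the cone is again minimal.\<close>

lemma lin_res_cone:
  fixes J L :: "'k::field mpol set"
  assumes "lin_res n d J \<rho>" and "lin_res n 1 L \<kappa>"
    and m: "m \<in> carrier (polyR n)" "homog d m"
    and L: "\<And>c. c \<in> carrier (polyR n) \<Longrightarrow> c \<in> L \<longleftrightarrow> m * c \<in> J"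
    and neg: "\<And>p. p \<in> J \<Longrightarrow> - p \<in> J"
  shows "lin_res n d {p + m * c | p c. p \<in> J \<and> c \<in> carrier (polyR n)}
    (\<lambda>i. case i of 0 \<Rightarrow> 1 | Suc i' \<Rightarrow> \<rho> i + \<kappa> i')"
proof -
  obtain f where f: "gr_exact n \<rho> (lin_shift d) f" and \<rho>0: "\<rho> 0 = 1"
    and f0: "f 0 ` vecs n (\<rho> 1) = {v \<in> vecs n 1. v 0 \<in> J}"
    using assms(1) by (auto simp: lin_res_def resolves_def)
  obtain g where g: "gr_exact n \<kappa> (lin_shift 1) g" and \<kappa>0: "\<kappa> 0 = 1"
    and g0: "g 0 ` vecs n (\<kappa> 1) = {v \<in> vecs n 1. v 0 \<in> L}"
    using assms(2) by (auto simp: lin_res_def resolves_def)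
  \<comment> \<open>Twisting by the degree of \<open>m\<close> brings position \<open>i\<close> for
    \<open>L\<close> into the degree of position \<open>i + 1\<close> for \<open>J\<close>, which is
    where the cone places it.\<close>
  have shift: "(\<lambda>j. lin_shift 1 i j + d) = lin_shift d (Suc i)" for i
    by (auto simp: lin_shift_def)
  have hom_f: "grhom n (\<rho> (Suc i)) (lin_shift d (Suc i)) (\<rho> i) (lin_shift d i) (f i)" for i
    by (rule gr_exact_grhom[OF f])
  have hom_g: "grhom n (\<kappa> (Suc i)) (lin_shift d (Suc (Suc i))) (\<kappa> i) (lin_shift d (Suc i)) (g i)" for i
    using grhom_shift[OF gr_exact_grhom[OF g, of i], of d] by (simp only: shift)
  have g': "gr_exact n \<kappa> (\<lambda>i. lin_shift d (Suc i)) g"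
    using g hom_g by (simp add: gr_exact_def)
  define a0 :: "(nat \<Rightarrow> 'k mpol) \<Rightarrow> nat \<Rightarrow> 'k mpol" where "a0 = (\<lambda>v j. m * v j)"
  have "homog (e + d) (m * p)" if "homog e p" for e p
    using homog_mult[OF m(2) that] by (simp add: add.commute)
  from this[of "_ - d"] have a0: "grhom n (\<kappa> 0) (lin_shift d (Suc 0)) (\<rho> 0) (lin_shift d 0) a0"
    using m(1) \<rho>0 \<kappa>0
    by (auto simp: grhom_iff a0_def in_vecs in_free_component lin_shift_def polyR_mult fun_eq_iff distrib_left mult.left_commute)
  have "a0 (g 0 v) \<in> f 0 ` vecs n (\<rho> 1)" if "v \<in> vecs n (\<kappa> 1)" for v
  proof -
    have "g 0 v \<in> vecs n 1" "g 0 v 0 \<in> L"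
      using that g0 by blast+
    then show ?thesis
      unfolding f0 using L m(1) by (auto simp: a0_def in_vecs polyR_mult)
  qed
  from comparison_maps[OF f g' a0 this] obtain \<alpha> where \<alpha>: "\<alpha> 0 = a0"
      "\<And>i. grhom n (\<kappa> i) (lin_shift d (Suc i)) (\<rho> i) (lin_shift d i) (\<alpha> i)"
      "\<And>i v. v \<in> vecs n (\<kappa> (Suc i)) \<Longrightarrow> f i (\<alpha> (Suc i) v) = \<alpha> i (g i v)"
    by blast
  \<comment> \<open>The complex of \<open>L\<close> moved up by one, with zero put in position 0, so
    that the cone still begins with the ring alone.\<close>
  define \<kappa>' where "\<kappa>' = case_nat 0 \<kappa>"
  define g'' where "g'' = case_nat (\<lambda>_. 0) g"
  define \<pi> where "\<pi> = (\<lambda>i. \<rho> i + \<kappa>' i)"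
  \<comment> \<open>The cone differential (u, w) |-> (f u + \<alpha> w, - g w). The sign makes the
    two contributions of \<open>w\<close> cancel in the composite of two differentials.\<close>
  define D where "D = (\<lambda>i v. vappend (\<rho> i)
    (f i (vtake (\<rho> (Suc i)) v) + \<alpha> i (vdrop (\<rho> (Suc i)) v)) (- g'' i (vdrop (\<rho> (Suc i)) v)))"
  have shift_const: "lin_shift d i = (\<lambda>_. lin_shift d i 0)" for d i
    by (simp add: lin_shift_def)
  have hom_g'': "grhom n (\<kappa> i) (lin_shift d (Suc i)) (\<kappa>' i) (lin_shift d i) (g'' i)" for i
    using hom_g by (cases i) (auto simp: \<kappa>'_def g''_def grhom_null)
  have hom_take: "grhom n (\<pi> (Suc i)) (lin_shift d (Suc i)) (\<rho> (Suc i)) (lin_shift d (Suc i)) (vtake (\<rho> (Suc i)))"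
    and hom_drop: "grhom n (\<pi> (Suc i)) (lin_shift d (Suc i)) (\<kappa> i) (lin_shift d (Suc i)) (vdrop (\<rho> (Suc i)))" for i
    unfolding \<pi>_def \<kappa>'_def using grhom_vtake grhom_vdrop by (simp_all add: lin_shift_def)
  have hom_D: "grhom n (\<pi> (Suc i)) (lin_shift d (Suc i)) (\<pi> i) (lin_shift d i) (D i)" for i
  proof -
    let ?c = "lin_shift d i 0"
    have "grhom n (\<pi> (Suc i)) (lin_shift d (Suc i)) (\<rho> i) (\<lambda>_. ?c)
        (\<lambda>v. f i (vtake (\<rho> (Suc i)) v) + \<alpha> i (vdrop (\<rho> (Suc i)) v))"
      unfolding shift_const[of d i, symmetric]
      by (rule grhom_plus[OF grhom_compose[OF hom_take hom_f] grhom_compose[OF hom_drop \<alpha>(2)]])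
    moreover have "grhom n (\<pi> (Suc i)) (lin_shift d (Suc i)) (\<kappa>' i) (\<lambda>_. ?c)
        (\<lambda>v. - g'' i (vdrop (\<rho> (Suc i)) v))"
      unfolding shift_const[of d i, symmetric]
      by (rule grhom_neg[OF grhom_compose[OF hom_drop hom_g'']])
    ultimately show ?thesis
      unfolding D_def \<pi>_def[THEN fun_cong, of i] by (subst shift_const[of d i]) (rule grhom_vappend)
  qed
  have split: "\<exists>u\<in>vecs n (\<rho> (Suc i)). \<exists>w\<in>vecs n (\<kappa> i). v = vappend (\<rho> (Suc i)) u w"
    if "v \<in> vecs n (\<pi> (Suc i))" for v i
    using grhom_closed[OF hom_take that] grhom_closed[OF hom_drop that] vappend_vtake_vdrop by metis
  have join: "vappend (\<rho> (Suc i)) u w \<in> vecs n (\<pi> (Suc i))"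
    if "u \<in> vecs n (\<rho> (Suc i))" "w \<in> vecs n (\<kappa> i)" for u w i
    using vappend_vecs[OF that] by (simp add: \<pi>_def \<kappa>'_def)
  have D: "D i (vappend (\<rho> (Suc i)) u w) = vappend (\<rho> i) (f i u + \<alpha> i w) (- g'' i w)"
    if "u \<in> vecs n (\<rho> (Suc i))" for u w i
    using that by (simp add: D_def vtake_vappend vdrop_vappend)
  have exact: "{v \<in> vecs n (\<pi> (Suc i)). D i v = 0} = D (Suc i) ` vecs n (\<pi> (Suc (Suc i)))" for i
  proof (intro equalityI subsetI)
    fix v assume "v \<in> {v \<in> vecs n (\<pi> (Suc i)). D i v = 0}"
    then obtain u w where u: "u \<in> vecs n (\<rho> (Suc i))" and w: "w \<in> vecs n (\<kappa> i)"
      and v: "v = vappend (\<rho> (Suc i)) u w" and "D i v = 0"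
      using split by blast
    moreover have "f i u + \<alpha> i w \<in> vecs n (\<rho> i)"
      by (intro vecs_add grhom_closed[OF hom_f u] grhom_closed[OF \<alpha>(2) w])
    ultimately have z: "f i u + \<alpha> i w = 0" "g'' i w = 0"
      by (auto simp: D vappend_eq_0_iff)
    have "w \<in> g i ` vecs n (\<kappa> (Suc i))"
    proof (cases i)
      \<comment> \<open>Here the colon ideal enters: f u + m w = 0 says that m w lies in
        \<open>J\<close>, so w lies in \<open>L\<close>, the image of \<open>g 0\<close>.\<close>
      case 0
      have "\<alpha> 0 w = f 0 (- u)"
        using minus_unique[OF z(1)] u by (simp add: \<open>i = 0\<close> grhom_uminus[OF hom_f])
      moreover have "f 0 (- u) \<in> {v \<in> vecs n 1. v 0 \<in> J}"
        using u f0 vecs_uminus[of u] by (auto simp: \<open>i = 0\<close>)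
      ultimately have "a0 w 0 \<in> J"
        by (simp add: \<alpha>(1))
      then have "m * w 0 \<in> J"
        by (simp add: a0_def)
      then have "w \<in> {v \<in> vecs n 1. v 0 \<in> L}"
        using L w vecsD(1)[OF w] by (simp add: \<open>i = 0\<close> \<kappa>0)
      then show ?thesis using g0 by (simp add: \<open>i = 0\<close>)
    next
      case (Suc i')
      then show ?thesis
        using gr_exact_kernel[OF g, of w i'] w z(2) by (simp add: g''_def)
    qed
    then obtain y where y: "y \<in> vecs n (\<kappa> (Suc i))" "w = g i y"
      by blast
    define w' where "w' = - y"
    have w': "w' \<in> vecs n (\<kappa> (Suc i))" "w = - g i w'"
      using y by (simp_all add: w'_def vecs_uminus grhom_uminus[OF hom_g])
    \<comment> \<open>Subtracting the part of \<open>u\<close> explained by \<open>w'\<close> leaves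
      a cycle of \<open>f\<close>, to which exactness of \<open>f\<close> applies.\<close>
    let ?u = "u - \<alpha> (Suc i) w'"
    have \<alpha>w': "\<alpha> (Suc i) w' \<in> vecs n (\<rho> (Suc i))"
      by (rule grhom_closed[OF \<alpha>(2) w'(1)])
    have "f i ?u = f i u - \<alpha> i (g i w')"
      by (simp add: grhom_diff[OF hom_f u \<alpha>w'] \<alpha>(3)[OF w'(1)])
    also have "\<dots> = f i u + \<alpha> i w"
      by (simp add: w'(2) grhom_uminus[OF \<alpha>(2) grhom_closed[OF hom_g w'(1)]])
    finally have "f i ?u = 0" by (simp add: z)
    then obtain u' where u': "u' \<in> vecs n (\<rho> (Suc (Suc i)))" "?u = f (Suc i) u'"
      using gr_exact_kernel[OF f vecs_diff[OF u \<alpha>w']] by blast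
    have "v = D (Suc i) (vappend (\<rho> (Suc (Suc i))) u' w')"
      using u'(2) w'(2) by (simp add: D[OF u'(1)] v g''_def eq_diff_eq[symmetric] flip: u'(2))
    then show "v \<in> D (Suc i) ` vecs n (\<pi> (Suc (Suc i)))"
      using join[OF u'(1) w'(1)] by blast
  next
    fix v assume "v \<in> D (Suc i) ` vecs n (\<pi> (Suc (Suc i)))"
    then obtain u w where u: "u \<in> vecs n (\<rho> (Suc (Suc i)))" and w: "w \<in> vecs n (\<kappa> (Suc i))"
      and v: "v = D (Suc i) (vappend (\<rho> (Suc (Suc i))) u w)"
      using split by blast
    have gw: "g i w \<in> vecs n (\<kappa> i)" and fu: "f (Suc i) u \<in> vecs n (\<rho> (Suc i))"
      and \<alpha>w: "\<alpha> (Suc i) w \<in> vecs n (\<rho> (Suc i))"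
      using grhom_closed[OF hom_g w] grhom_closed[OF hom_f u] grhom_closed[OF \<alpha>(2) w] .
    have v': "v = vappend (\<rho> (Suc i)) (f (Suc i) u + \<alpha> (Suc i) w) (- g i w)"
      by (simp add: v D[OF u] g''_def)
    have "f i (f (Suc i) u + \<alpha> (Suc i) w) + \<alpha> i (- g i w) = 0"
      by (simp add: grhom_add[OF hom_f fu \<alpha>w] gr_exact_compose[OF f u] \<alpha>(3)[OF w] grhom_uminus[OF \<alpha>(2) gw])
    moreover have "g'' i (- g i w) = 0"
      using gr_exact_compose[OF g, of w] w
      by (cases i) (auto simp: g''_def grhom_uminus[OF hom_g gr_exact_closed[OF g]])
    ultimately have "D i v = 0"
      by (simp add: v' D[OF vecs_add[OF fu \<alpha>w]] vappend_eq_0_iff[OF vecs_zero[of n]])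
    moreover have "v \<in> vecs n (\<pi> (Suc i))"
      unfolding v' by (intro join vecs_add fu \<alpha>w vecs_uminus gw)
    ultimately show "v \<in> {v \<in> vecs n (\<pi> (Suc i)). D i v = 0}" by simp
  qed
  have image: "D 0 ` vecs n (\<pi> 1) =
      {v \<in> vecs n 1. v 0 \<in> {p + m * c | p c. p \<in> J \<and> c \<in> carrier (polyR n)}}" (is "_ = ?I")
  proof (intro equalityI subsetI)
    fix v assume v: "v \<in> D 0 ` vecs n (\<pi> 1)"
    then obtain u w where u: "u \<in> vecs n (\<rho> 1)" and w: "w \<in> vecs n (\<kappa> 0)"
      and "v = D 0 (vappend (\<rho> (Suc 0)) u w)"
      using split[of _ 0] by fastforce
    then have "v = vappend (\<rho> 0) (f 0 u + a0 w) (- g'' 0 w)"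
      by (simp add: D \<alpha>(1))
    then have "v 0 = f 0 u 0 + m * w 0"
      using \<rho>0 by (simp add: vappend_def a0_def)
    moreover have "f 0 u 0 \<in> J"
      using u f0 by blast
    moreover have "v \<in> vecs n 1"
      using v grhom_closed[OF hom_D[of 0]] \<rho>0 by (auto simp: \<pi>_def \<kappa>'_def)
    ultimately show "v \<in> ?I"
      using vecsD(1)[OF w] by blast
  next
    fix v assume "v \<in> ?I"
    then obtain p c where v: "v \<in> vecs n 1" "v 0 = p + m * c" and p: "p \<in> J" "c \<in> carrier (polyR n)"
      by blast
    let ?w = "\<lambda>j. if j = 0 then c else 0"
    have w: "?w \<in> vecs n (\<kappa> 0)"
      using p \<kappa>0 by (auto simp: in_vecs polyR_zero)
    \<comment> \<open>That \<open>p\<close> belongs to the polynomial ring is read off from p = v 0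
      - m c.\<close>
    have "(\<lambda>j. if j = 0 then p else 0) \<in> {v \<in> vecs n 1. v 0 \<in> J}"
      using p v vecsD(1)[OF v(1), of 0] polyR_diff[of "v 0" n "m * c"] m(1)
      by (auto simp: in_vecs polyR_zero polyR_mult)
    then obtain u where u: "u \<in> vecs n (\<rho> 1)" "f 0 u = (\<lambda>j. if j = 0 then p else 0)"
      unfolding f0[symmetric] by auto
    have "D 0 (vappend (\<rho> (Suc 0)) u ?w) = vappend 1 (f 0 u + a0 ?w) 0"
      using u(1) by (simp add: D \<rho>0 \<alpha>(1) g''_def)
    also have "\<dots> = v"
      using u(2) v(2) vecsD(2)[OF v(1)] by (auto simp: vappend_def fun_eq_iff a0_def)
    finally have "v = D 0 (vappend (\<rho> (Suc 0)) u ?w)" ..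
    then show "v \<in> D 0 ` vecs n (\<pi> 1)"
      using join[of u 0 ?w] u(1) w by auto
  qed
  have \<pi>: "\<pi> = (\<lambda>i. case i of 0 \<Rightarrow> 1 | Suc i' \<Rightarrow> \<rho> i + \<kappa> i')"
    using \<rho>0 by (auto simp: \<pi>_def \<kappa>'_def split: nat.split)
  have "resolves n {p + m * c | p c. p \<in> J \<and> c \<in> carrier (polyR n)} \<pi> (lin_shift d) D"
    unfolding resolves_def gr_exact_def using hom_D exact image
    by (simp add: \<pi> lin_shift_def)
  then show ?thesis
    unfolding lin_res_def \<pi> by blast
qed

section \<open>Monomial ideals\<close>

text \<open>A monomial ideal is represented by the exponents of its monomials. \<open>up n B\<close>
  is that set for the ideal generated by the monomials of \<open>B\<close>, and
  \<open>polys_on\<close> turns it back into the ideal; \<open>up n E = E\<close> expresses closure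
  under multiplication by monomials.\<close>

definition up :: "nat \<Rightarrow> expo set \<Rightarrow> expo set" where
  "up n B = {b \<in> expos n. \<exists>c\<in>B. \<forall>k. Poly_Mapping.lookup c k \<le> Poly_Mapping.lookup b k}"

definition polys_on :: "expo set \<Rightarrow> 'k::field mpol set" where
  "polys_on E = {p. Poly_Mapping.keys p \<subseteq> E}"

lemma expos_add: "b \<in> expos n \<Longrightarrow> c \<in> expos n \<Longrightarrow> b + c \<in> expos n"
  using keys_add[of b c] by (auto simp: expos_def)

lemma expos_iff: "b \<in> expos n \<longleftrightarrow> (\<forall>k. k \<notin> {1..n} \<longrightarrow> Poly_Mapping.lookup b k = 0)"
  by (auto simp: expos_def in_keys_iff subset_iff)

lemma expos_minus: "b \<in> expos n \<Longrightarrow> b - c \<in> expos n"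
  by (auto simp: expos_iff lookup_minus)

lemma expos_single: "1 \<le> i \<Longrightarrow> i \<le> n \<Longrightarrow> Poly_Mapping.single i c \<in> expos n"
  by (auto simp: expos_def)

lemma expo_minus_add:
  "(\<And>k. Poly_Mapping.lookup c k \<le> Poly_Mapping.lookup b k) \<Longrightarrow> c + (b - c) = (b :: expo)"
  by (rule poly_mapping_eqI) (simp add: lookup_add lookup_minus)

lemma up_subset: "up n B \<subseteq> expos n"
  by (auto simp: up_def)

lemma up_mono: "B \<subseteq> C \<Longrightarrow> up n B \<subseteq> up n C"
  by (auto simp: up_def)

lemma up_self: "B \<subseteq> expos n \<Longrightarrow> B \<subseteq> up n B"
  by (auto simp: up_def)

lemma up_add: "b \<in> up n B \<Longrightarrow> c \<in> expos n \<Longrightarrow> b + c \<in> up n B"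
  by (force simp: up_def expos_add lookup_add intro: trans_le_add1)

lemma up_up [simp]: "up n (up n B) = up n B"
  by (auto simp: up_def) (metis le_trans)

lemma polys_on_subset_polyR: "polys_on (up n B) \<subseteq> carrier (polyR n)"
  using up_subset[of n B] by (fastforce simp: polys_on_def in_polyR)

lemma xmon_in_polys_on: "xmon b \<in> polys_on E \<longleftrightarrow> b \<in> E"
  by (simp add: polys_on_def)

lemma polys_on_inject: "polys_on E = (polys_on E' :: 'k::field mpol set) \<longleftrightarrow> E = E'"
proof
  assume "polys_on E = (polys_on E' :: 'k mpol set)"
  then have "xmon b \<in> (polys_on E :: 'k mpol set) \<longleftrightarrow> xmon b \<in> (polys_on E' :: 'k mpol set)" for b
    by simp
  then show "E = E'"
    by (simp add: xmon_in_polys_on set_eq_iff)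
qed simp

lemma polys_on_mono: "E \<subseteq> E' \<Longrightarrow> polys_on E \<subseteq> polys_on E'"
  by (auto simp: polys_on_def)

lemma polys_on_mult:
  assumes "p \<in> polys_on (up n B)" "q \<in> carrier (polyR n)"
  shows "q * p \<in> polys_on (up n B)"
proof -
  have "x + y \<in> up n B" if "x \<in> Poly_Mapping.keys q" "y \<in> Poly_Mapping.keys p" for x y
    using that assms up_add[of y n B x] by (auto simp: polys_on_def in_polyR add.commute)
  then show ?thesis
    using keys_mult[of q p] by (auto simp: polys_on_def)
qed

lemma ideal_polys_on: "ideal (polys_on (up n B)) (polyR n :: ('k::field mpol) ring)"
proof (rule idealI)
  interpret R: cring "polyR n :: ('k mpol) ring" by (rule cring_polyR)
  show "ring (polyR n :: ('k mpol) ring)"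
    by (rule cring.axioms(1)[OF cring_polyR])
  show "subgroup (polys_on (up n B)) (add_monoid (polyR n :: ('k mpol) ring))"
  proof
    fix p :: "'k mpol" assume p: "p \<in> polys_on (up n B)"
    then have "p \<in> carrier (polyR n)"
      using polys_on_subset_polyR by blast
    then have "\<ominus>\<^bsub>polyR n\<^esub> p = - p"
      by (intro R.minus_equality) (simp_all add: polyR_simps polyR_uminus)
    then show "inv\<^bsub>add_monoid (polyR n)\<^esub> p \<in> polys_on (up n B)"
      using p by (simp add: polys_on_def a_inv_def)
  next
    show "polys_on (up n B) \<subseteq> carrier (add_monoid (polyR n :: ('k mpol) ring))"
      using polys_on_subset_polyR by simp
  next
    fix p q :: "'k mpol" assume "p \<in> polys_on (up n B)" "q \<in> polys_on (up n B)"
    then show "p \<otimes>\<^bsub>add_monoid (polyR n)\<^esub> q \<in> polys_on (up n B)"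
      using keys_add[of p q] by (auto simp: polys_on_def polyR_simps)
  qed (simp add: polys_on_def polyR_simps)
next
  fix p x :: "'k mpol"
  assume "p \<in> polys_on (up n B)" "x \<in> carrier (polyR n)"
  from polys_on_mult[OF this]
  show "x \<otimes>\<^bsub>polyR n\<^esub> p \<in> polys_on (up n B)" "p \<otimes>\<^bsub>polyR n\<^esub> x \<in> polys_on (up n B)"
    by (simp_all add: polyR_simps mult.commute)
qed

text \<open>Each term of a polynomial supported on \<open>up n B\<close> is a multiple of one
  generator, so the polynomial is a sum of elements of the ideal.\<close>

lemma genideal_xmon:
  fixes B :: "expo set"
  assumes B: "B \<subseteq> expos n"
  shows "Idl\<^bsub>polyR n\<^esub> (xmon ` B) = (polys_on (up n B) :: 'k::field mpol set)"
proof
  interpret R: cring "polyR n :: ('k mpol) ring" by (rule cring_polyR)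
  have car: "xmon ` B \<subseteq> carrier (polyR n :: ('k mpol) ring)"
    using B by (auto simp: in_polyR)
  show "Idl\<^bsub>polyR n\<^esub> (xmon ` B) \<subseteq> (polys_on (up n B) :: 'k mpol set)"
    using up_self[OF B] by (intro R.genideal_minimal ideal_polys_on) (auto simp: xmon_in_polys_on)
  interpret I: ideal "Idl\<^bsub>polyR n\<^esub> (xmon ` B) :: 'k mpol set" "polyR n :: ('k mpol) ring"
    by (rule R.genideal_ideal[OF car])
  have sum: "sum F X \<in> Idl\<^bsub>polyR n\<^esub> (xmon ` B)"
    if "\<And>b. b \<in> X \<Longrightarrow> F b \<in> Idl\<^bsub>polyR n\<^esub> (xmon ` B)" for F :: "expo \<Rightarrow> 'k mpol" and X
    using that
  proof (induction X rule: infinite_finite_induct)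
    case (insert x X)
    then show ?case using I.a_closed[of "F x" "sum F X"] by (simp add: polyR_simps)
  qed (use I.zero_closed in \<open>simp_all add: polyR_simps\<close>)
  show "polys_on (up n B) \<subseteq> Idl\<^bsub>polyR n\<^esub> (xmon ` B :: 'k mpol set)"
  proof
    fix p :: "'k mpol" assume p: "p \<in> polys_on (up n B)"
    have "p = (\<Sum>b\<in>Poly_Mapping.keys p. Poly_Mapping.single b (Poly_Mapping.lookup p b))"
      by (rule poly_mapping_eqI) (auto simp: lookup_sum lookup_single when_def in_keys_iff)
    moreover have "\<dots> \<in> Idl\<^bsub>polyR n\<^esub> (xmon ` B)"
    proof (rule sum)
      fix b assume "b \<in> Poly_Mapping.keys p"
      then obtain c where c: "c \<in> B" "b \<in> expos n" "\<And>k. Poly_Mapping.lookup c k \<le> Poly_Mapping.lookup b k"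
        using p by (auto simp: polys_on_def up_def)
      let ?q = "Poly_Mapping.single (b - c) (Poly_Mapping.lookup p b)"
      have "?q \<in> carrier (polyR n)"
        using c expos_minus[of b n c] by (auto simp: in_polyR)
      moreover have "(xmon c :: 'k mpol) \<in> Idl\<^bsub>polyR n\<^esub> (xmon ` B)"
        using c(1) by (intro subsetD[OF R.genideal_self[OF car]]) simp
      ultimately have "xmon c * ?q \<in> Idl\<^bsub>polyR n\<^esub> (xmon ` B)"
        using I.I_r_closed by (simp add: polyR_simps)
      then show "Poly_Mapping.single b (Poly_Mapping.lookup p b) \<in> Idl\<^bsub>polyR n\<^esub> (xmon ` B)"
        by (simp add: xmon_def mult_single expo_minus_add[OF c(3)])
    qed
    ultimately show "p \<in> Idl\<^bsub>polyR n\<^esub> (xmon ` B)" by simp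
  qed
qed

text \<open>The cone for a monomial \<open>m\<close>. Multiplication by \<open>m\<close> only
  translates exponents, so the colon condition can be checked on monomials, and \<open>C\<close> is
  the exponent set of the colon ideal.\<close>

lemma lin_res_insert:
  assumes J: "lin_res n d (polys_on (up n B) :: 'k::field mpol set) \<rho>"
    and L: "lin_res n 1 (polys_on C :: 'k mpol set) \<kappa>"
    and m: "m \<in> expos n" "int (mdeg m) = d"
    and C: "\<And>b. b \<in> expos n \<Longrightarrow> b \<in> C \<longleftrightarrow> m + b \<in> up n B"
  shows "lin_res n d (polys_on (up n (insert m B)) :: 'k mpol set)
    (\<lambda>i. case i of 0 \<Rightarrow> 1 | Suc i' \<Rightarrow> \<rho> i + \<kappa> i')"
proof -
  let ?J = "{p + xmon m * c | p c. p \<in> polys_on (up n B) \<and> c \<in> carrier (polyR n)} :: 'k mpol set"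
  have "lin_res n d ?J (\<lambda>i. case i of 0 \<Rightarrow> 1 | Suc i' \<Rightarrow> \<rho> i + \<kappa> i')"
  proof (rule lin_res_cone[OF J L])
    show "xmon m \<in> carrier (polyR n :: ('k mpol) ring)" "homog d (xmon m :: 'k mpol)"
      using m by (auto simp: in_polyR homog_def)
    show "c \<in> polys_on C \<longleftrightarrow> xmon m * c \<in> polys_on (up n B)" if "c \<in> carrier (polyR n)" for c :: "'k mpol"
      using C that by (auto simp: polys_on_def keys_xmon_mult in_polyR)
    show "- p \<in> polys_on (up n B)" if "p \<in> polys_on (up n B)" for p :: "'k mpol"
      using that by (simp add: polys_on_def)
  qed
  also have "?J = polys_on (up n (insert m B))"
  proof (intro equalityI subsetI)
    fix q :: "'k mpol" assume "q \<in> ?J"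
    then obtain p c where q: "q = p + xmon m * c" and p: "p \<in> polys_on (up n B)" and c: "c \<in> carrier (polyR n)"
      by blast
    have "Poly_Mapping.keys (xmon m * c) \<subseteq> up n (insert m B)"
      using c m by (auto simp: keys_xmon_mult in_polyR up_def lookup_add intro: expos_add)
    moreover have "up n B \<subseteq> up n (insert m B)"
      by (auto simp: up_def)
    ultimately show "q \<in> polys_on (up n (insert m B))"
      using p keys_add[of p "xmon m * c"] by (auto simp: polys_on_def q)
  next
    fix q :: "'k mpol" assume q: "q \<in> polys_on (up n (insert m B))"
    \<comment> \<open>The terms of \<open>q\<close> outside the old ideal are all divisible by
      \<open>m\<close>, which gives the decomposition required by the cone.\<close>
    let ?r = "restr (- up n B) q"
    have "\<exists>c\<in>carrier (polyR n). ?r = xmon m * c"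
    proof (intro bexI)
      let ?c = "\<Sum>b\<in>Poly_Mapping.keys ?r. Poly_Mapping.single (b - m) (Poly_Mapping.lookup q b)"
      have b: "b \<in> expos n" "m + (b - m) = b" if "b \<in> Poly_Mapping.keys ?r" for b
      proof -
        have "b \<in> up n (insert m B)" "b \<notin> up n B"
          using that q by (auto simp: keys_restr polys_on_def)
        then show "b \<in> expos n" "m + (b - m) = b"
          by (auto simp: up_def intro!: expo_minus_add)
      qed
      have "xmon m * ?c = (\<Sum>b\<in>Poly_Mapping.keys ?r. Poly_Mapping.single b (Poly_Mapping.lookup q b))"
        unfolding sum_distrib_left
        by (intro sum.cong refl) (simp add: xmon_def mult_single b)
      also have "\<dots> = ?r"
        by (rule poly_mapping_eqI)
          (auto simp: lookup_sum lookup_single when_def lookup_restr keys_restr in_keys_iff)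
      finally show "?r = xmon m * ?c" ..
      show "?c \<in> carrier (polyR n)"
        using b(1) by (intro polyR_sum) (auto simp: in_polyR intro: expos_minus)
    qed
    moreover have "restr (up n B) q \<in> polys_on (up n B)"
      by (simp add: polys_on_def keys_restr)
    ultimately show "q \<in> ?J"
      using restr_split[of q "up n B"] by fastforce
  qed
  finally show ?thesis .
qed

section \<open>Resolutions of ideals generated by at most two variables\<close>

lemma lin_res_empty: "lin_res n d (polys_on {} :: 'k::field mpol set) (\<lambda>i. if i = 0 then 1 else 0)"
proof -
  have v0: "vecs n 0 = {0 :: nat \<Rightarrow> 'k mpol}"
    by (rule vecs_0)
  have "{v \<in> vecs n 1. v 0 = 0} = {0 :: nat \<Rightarrow> 'k mpol}"
    by (auto simp: in_vecs fun_eq_iff polyR_zero) (metis One_nat_def Suc_leI gr0I)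
  then have "resolves n (polys_on {} :: 'k mpol set) (\<lambda>i. if i = 0 then 1 else 0) (lin_shift d) (\<lambda>_ _. 0)"
    by (auto simp: resolves_def gr_exact_def v0 grhom_null lin_shift_def polys_on_def)
  then show ?thesis
    unfolding lin_res_def by blast
qed

lemma lin_res_var:
  assumes "1 \<le> p" "p \<le> n"
  shows "lin_res n 1 (polys_on {b \<in> expos n. Poly_Mapping.lookup b p \<ge> 1} :: 'k::field mpol set)
    (\<lambda>i. if i \<le> 1 then 1 else 0)"
proof -
  have 0: "up n {} = {}" by (simp add: up_def)
  have "lin_res n 1 (polys_on (up n {Poly_Mapping.single p 1}) :: 'k mpol set)
      (\<lambda>i. case i of 0 \<Rightarrow> 1 | Suc i' \<Rightarrow> (if i = 0 then 1 else 0) + (if i' = 0 then 1 else 0))"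
    using assms lin_res_empty
    by (intro lin_res_insert[where C = "{}"]) (auto simp: 0 expos_single)
  moreover have "(\<lambda>i. case i of 0 \<Rightarrow> 1 | Suc i' \<Rightarrow> (if i = 0 then 1 else 0) + (if i' = 0 then 1 else 0)) =
      (\<lambda>i. if i \<le> 1 then 1 else (0::nat))"
    by (auto simp: fun_eq_iff split: nat.split)
  moreover have "up n {Poly_Mapping.single p 1} = {b \<in> expos n. Poly_Mapping.lookup b p \<ge> 1}"
    by (auto simp: up_def lookup_single when_def)
  ultimately show ?thesis by simp
qed

text \<open>As p and q differ, the colon ideal of (x_p) by x_q is again (x_p). The cone of two
  copies of its resolution has the Koszul ranks 1, 2, 1.\<close>

lemma lin_res_two_vars:
  assumes "1 \<le> p" "p \<le> n" "1 \<le> q" "q \<le> n" "p \<noteq> q"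
  shows "lin_res n 1
    (polys_on {b \<in> expos n. Poly_Mapping.lookup b p \<ge> 1 \<or> Poly_Mapping.lookup b q \<ge> 1} :: 'k::field mpol set)
    (\<lambda>i. case i of 0 \<Rightarrow> 1 | Suc 0 \<Rightarrow> 2 | Suc (Suc 0) \<Rightarrow> 1 | _ \<Rightarrow> 0)"
proof -
  let ?C = "{b \<in> expos n. Poly_Mapping.lookup b p \<ge> 1}"
  have C: "up n {Poly_Mapping.single p 1} = ?C"
    by (auto simp: up_def lookup_single when_def)
  have "lin_res n 1 (polys_on (up n {Poly_Mapping.single q 1, Poly_Mapping.single p 1}) :: 'k mpol set)
      (\<lambda>i. case i of 0 \<Rightarrow> 1 | Suc i' \<Rightarrow> (if i \<le> 1 then 1 else 0) + (if i' \<le> 1 then 1 else 0))"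
    using assms lin_res_var
    by (intro lin_res_insert[where C = ?C])
      (auto simp: C[unfolded One_nat_def] expos_single expos_add lookup_add lookup_single)
  moreover have "(\<lambda>i. case i of 0 \<Rightarrow> 1 | Suc i' \<Rightarrow> (if i \<le> 1 then 1 else 0) + (if i' \<le> 1 then 1 else 0)) =
      (\<lambda>i. case i of 0 \<Rightarrow> 1 | Suc 0 \<Rightarrow> 2 | Suc (Suc 0) \<Rightarrow> 1 | _ \<Rightarrow> (0::nat))"
    by (auto simp: fun_eq_iff split: nat.split)
  moreover have "up n {Poly_Mapping.single q 1, Poly_Mapping.single p 1} =
      {b \<in> expos n. Poly_Mapping.lookup b p \<ge> 1 \<or> Poly_Mapping.lookup b q \<ge> 1}"
    by (auto simp: up_def lookup_single when_def)
  ultimately show ?thesis by simp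
qed


section \<open>Minimal generators of monomial ideals\<close>

lemma xmon_mem_image: "xmon b \<in> (xmon ` A :: 'k::field mpol set) \<longleftrightarrow> b \<in> A"
  using inj_image_mem_iff[OF inj_xmon] .

lemma monomial_ideal_iff: "monomial_ideal n I \<longleftrightarrow> (\<exists>B. I = polys_on (up n B))"
proof
  assume "monomial_ideal n I"
  then show "\<exists>B. I = polys_on (up n B)"
    unfolding monomial_ideal_def monomials_def by (metis genideal_xmon subset_imageE)
next
  assume "\<exists>B. I = polys_on (up n B)"
  then obtain B where "I = polys_on (up n B)" ..
  then have "I = Idl\<^bsub>polyR n\<^esub> (xmon ` up n B)"
    by (simp add: genideal_xmon[OF up_subset])
  then show "monomial_ideal n I"
    unfolding monomial_ideal_def monomials_def using up_subset by (metis image_mono)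
qed

lemma mdeg_eq_0: "mdeg b = 0 \<Longrightarrow> b = 0"
  by (rule poly_mapping_eqI) (auto simp: mdeg_def in_keys_iff)

definition minexps :: "expo set \<Rightarrow> expo set" where
  "minexps E = {b \<in> E. \<forall>c\<in>E. (\<forall>k. Poly_Mapping.lookup c k \<le> Poly_Mapping.lookup b k) \<longrightarrow> c = b}"

text \<open>Passing to a proper divisor lowers the total degree, so the descent to a minimal
  exponent terminates.\<close>

lemma minexps_below:
  "b \<in> E \<Longrightarrow> \<exists>c\<in>minexps E. \<forall>k. Poly_Mapping.lookup c k \<le> Poly_Mapping.lookup b k"
proof (induction "mdeg b" arbitrary: b rule: less_induct)
  case less
  show ?case
  proof (cases "b \<in> minexps E")
    case False
    then obtain c where c: "c \<in> E" "\<And>k. Poly_Mapping.lookup c k \<le> Poly_Mapping.lookup b k" "c \<noteq> b"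
      using less.prems by (auto simp: minexps_def)
    have b: "c + (b - c) = b"
      by (rule expo_minus_add[OF c(2)])
    then have "mdeg (b - c) \<noteq> 0"
      using c(3) mdeg_eq_0[of "b - c"] by fastforce
    then have "mdeg c < mdeg b"
      using mdeg_add[of c "b - c"] b by simp
    from less.hyps[OF this c(1)] c(2) show ?thesis
      using le_trans by blast
  qed blast
qed

lemma up_minexps: "up n (minexps (up n B)) = up n B"
proof
  show "up n (minexps (up n B)) \<subseteq> up n B"
    by (auto simp: up_def minexps_def) (meson le_trans)
  show "up n B \<subseteq> up n (minexps (up n B))"
    using minexps_below[of _ "up n B"] up_subset[of n B] unfolding up_def[of n "minexps _"] by blast
qed

text \<open>A minimal exponent is divisible by a member of any generating set, and minimality makes
  the two equal; so the minimal exponents lie in every generating set.\<close>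

lemma mgens_polys_on: "mgens n (polys_on (up n B)) = (xmon ` minexps (up n B) :: 'k::field mpol set)"
  unfolding mgens_def
proof (rule Least_equality)
  have "minexps (up n B) \<subseteq> expos n"
    using up_subset[of n B] by (auto simp: minexps_def)
  then show "xmon ` minexps (up n B) \<subseteq> monomials n \<and>
      Idl\<^bsub>polyR n\<^esub> (xmon ` minexps (up n B)) = (polys_on (up n B) :: 'k mpol set)"
    by (auto simp: monomials_def genideal_xmon up_minexps)
next
  fix S :: "'k mpol set"
  assume S: "S \<subseteq> monomials n \<and> Idl\<^bsub>polyR n\<^esub> S = polys_on (up n B)"
  then obtain C where C: "C \<subseteq> expos n" "S = xmon ` C"
    unfolding monomials_def by (metis subset_imageE)
  then have E: "up n C = up n B"
    using S by (simp add: genideal_xmon polys_on_inject)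
  have "minexps (up n B) \<subseteq> C"
  proof
    fix b assume b: "b \<in> minexps (up n B)"
    then have "b \<in> up n C"
      by (simp add: E minexps_def)
    then obtain c where c: "c \<in> C" "\<forall>k. Poly_Mapping.lookup c k \<le> Poly_Mapping.lookup b k"
      by (auto simp: up_def)
    then have "c \<in> up n B"
      using up_self[OF C(1)] E by blast
    then show "b \<in> C"
      using b c by (auto simp: minexps_def)
  qed
  then show "xmon ` minexps (up n B) \<subseteq> S"
    by (auto simp: C)
qed

section \<open>Stable ideals\<close>

definition stable_exps :: "expo set \<Rightarrow> bool" where
  "stable_exps E \<longleftrightarrow> (\<forall>b\<in>E. \<forall>i. 1 \<le> i \<and> i < maxvar b \<longrightarrow>
     b - Poly_Mapping.single (maxvar b) 1 + Poly_Mapping.single i 1 \<in> E)"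

lemma stable_ideal_polys_on:
  "stable_ideal n (polys_on (up n B) :: 'k::field mpol set) \<longleftrightarrow> stable_exps (up n B)"
  using up_subset[of n B]
  by (auto simp: stable_ideal_def stable_exps_def monomial_ideal_iff xmon_in_polys_on)

lemma maxvar_le: "b \<in> expos n \<Longrightarrow> maxvar b \<le> n"
  by (auto simp: maxvar_def expos_def)

text \<open>The least stable ideal is the intersection of all stable ones containing
  \<open>T\<close>, formed on exponent sets, where both stability and closure under
  \<open>up\<close> survive intersection.\<close>

lemma Sta_properties:
  fixes T :: "'k::field mpol set"
  assumes "T \<subseteq> monomials n"
  shows "stable_ideal n (Sta n T)" and "T \<subseteq> Sta n T"
    and "\<And>J. stable_ideal n J \<Longrightarrow> T \<subseteq> J \<Longrightarrow> Sta n T \<subseteq> J"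
proof -
  define F where "F = {E. up n E = E \<and> stable_exps E \<and> T \<subseteq> polys_on E}"
  have "stable_exps (expos n)"
    unfolding stable_exps_def
    by (intro ballI allI impI expos_add expos_minus expos_single) (use maxvar_le in fastforce)+
  moreover have "up n (expos n) = expos n"
    using up_self[of "expos n" n] up_subset[of n] by blast
  \<comment> \<open>This keeps \<open>\<Inter>F\<close> inside \<open>expos n\<close>; the
    intersection of an empty family would be all exponents.\<close>
  ultimately have ex: "expos n \<in> F"
    using assms by (auto simp: F_def monomials_def polys_on_def)
  then have "\<Inter>F \<subseteq> up n (\<Inter>F)"
    by (intro up_self) blast
  moreover have "up n (\<Inter>F) \<subseteq> E" if "E \<in> F" for E
  proof -
    have "up n (\<Inter>F) \<subseteq> up n E"
      using that by (auto simp: up_def)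
    then show ?thesis
      using that by (simp add: F_def)
  qed
  ultimately have up: "up n (\<Inter>F) = \<Inter>F" by blast
  have st: "stable_exps (\<Inter>F)"
    unfolding stable_exps_def by (auto simp: F_def stable_exps_def)
  have TF: "T \<subseteq> polys_on (\<Inter>F)"
    by (auto simp: F_def polys_on_def)
  have "Sta n T = polys_on (up n (\<Inter>F))"
    unfolding Sta_def
  proof (rule Least_equality)
    show "stable_ideal n (polys_on (up n (\<Inter>F))) \<and> T \<subseteq> polys_on (up n (\<Inter>F))"
      using st TF stable_ideal_polys_on[of n "\<Inter>F"] by (simp add: up)
    fix J assume J: "stable_ideal n J \<and> T \<subseteq> J"
    then obtain B where B: "J = polys_on (up n B)"
      by (auto simp: stable_ideal_def monomial_ideal_iff)
    then have "up n B \<in> F"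
      using J by (simp add: F_def stable_ideal_polys_on)
    then show "polys_on (up n (\<Inter>F)) \<subseteq> J"
      unfolding B up by (intro polys_on_mono Inter_lower)
  qed
  note Sta = this
  show "stable_ideal n (Sta n T)"
    using st stable_ideal_polys_on[of n "\<Inter>F"] by (simp add: Sta up)
  show "T \<subseteq> Sta n T"
    unfolding Sta up by (rule TF)
  fix J assume J: "stable_ideal n J" "T \<subseteq> J"
  then obtain B where B: "J = polys_on (up n B)"
    by (auto simp: stable_ideal_def monomial_ideal_iff)
  then have "up n B \<in> F"
    using J by (simp add: F_def stable_ideal_polys_on)
  then show "Sta n T \<subseteq> J"
    unfolding B Sta up by (intro polys_on_mono Inter_lower)
qed

subsection \<open>Quadratic monomials\<close>

definition pexp :: "nat \<Rightarrow> nat \<Rightarrow> expo" where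
  "pexp i j = Poly_Mapping.single i 1 + Poly_Mapping.single j 1"

lemma lookup_pexp:
  "Poly_Mapping.lookup (pexp i j) t = (if t = i then 1 else 0) + (if t = j then 1 else 0)"
  by (simp add: pexp_def lookup_add lookup_single when_def)

lemma xvar_mult_xvar: "xvar i * xvar j = xmon (pexp i j)"
  by (simp add: xvar_def pexp_def xmon_mult)

lemma mdeg_pexp [simp]: "mdeg (pexp i j) = 2"
  by (simp add: pexp_def mdeg_add)

lemma pexp_commute: "pexp i j = pexp j i"
  by (simp add: pexp_def add.commute)

lemma keys_pexp: "Poly_Mapping.keys (pexp i j) = {i, j}"
  by (auto simp: in_keys_iff lookup_pexp split: if_splits)

lemma pexp_eq_iff:
  assumes "i \<le> j" "k \<le> l"
  shows "pexp i j = pexp k l \<longleftrightarrow> i = k \<and> j = l"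
proof
  assume "pexp i j = pexp k l"
  then have "{i, j} = {k, l}"
    by (metis keys_pexp)
  then show "i = k \<and> j = l"
    using assms by (auto simp: doubleton_eq_iff)
qed simp

lemma pexp_expos: "1 \<le> i \<Longrightarrow> i \<le> j \<Longrightarrow> j \<le> n \<Longrightarrow> pexp i j \<in> expos n"
  by (auto simp: expos_def keys_pexp)

lemma maxvar_pexp: "i \<le> j \<Longrightarrow> maxvar (pexp i j) = j"
  using keys_pexp[of i j] by (auto simp: maxvar_def max_def)

lemma pexp_move: "pexp i j - Poly_Mapping.single j 1 + Poly_Mapping.single l 1 = pexp i l"
  by (simp add: pexp_def)

lemma quadratic_exponent:
  assumes b: "b \<in> expos n" "mdeg b = 2"
  obtains i j where "1 \<le> i" "i \<le> j" "j \<le> n" "b = pexp i j"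
proof -
  have peel: "\<exists>i\<in>{1..n}. \<exists>c\<in>expos n. mdeg c = d \<and> b = Poly_Mapping.single i 1 + c"
    if "b \<in> expos n" "mdeg b = Suc d" for b d
  proof -
    have "b \<noteq> 0" using that by auto
    then obtain i where i: "i \<in> Poly_Mapping.keys b"
      using keys_eq_empty by blast
    let ?c = "b - Poly_Mapping.single i 1"
    have "b = Poly_Mapping.single i 1 + ?c"
      using i by (intro expo_minus_add[symmetric]) (auto simp: lookup_single when_def in_keys_iff Suc_le_eq)
    moreover from this have "mdeg ?c = d"
      using mdeg_add[of "Poly_Mapping.single i 1" ?c] that(2) by simp
    ultimately show ?thesis
      using i that(1) expos_minus[OF that(1), of "Poly_Mapping.single i 1"]
      unfolding expos_def by blast
  qed
  obtain i c where i: "i \<in> {1..n}" "c \<in> expos n" "mdeg c = 1" "b = Poly_Mapping.single i 1 + c"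
    using peel[of b 1] b by auto
  obtain j c' where j: "j \<in> {1..n}" "mdeg c' = 0" "c = Poly_Mapping.single j 1 + c'"
    using peel[of c 0] i by auto
  have "b = pexp i j"
    using i(4) j(3) mdeg_eq_0[OF j(2)] by (simp add: pexp_def)
  then show thesis
    using that[of i j] that[of j i] i(1) j(1) pexp_commute by (cases "i \<le> j") auto
qed

section \<open>Stable exponent sets generated in degree 2\<close>

context
  fixes n :: nat and E :: "expo set"
  assumes up: "up n E = E" and gen: "\<And>b. b \<in> minexps E \<Longrightarrow> mdeg b = 2"
    and stable: "stable_exps E" and nonempty: "E \<noteq> {}"
begin

lemma E_expos: "E \<subseteq> expos n"
  using up up_subset by metis

text \<open>A quadratic exponent of \<open>E\<close> lies above a generator of the same degree,
  hence equals it.\<close>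

lemma minexps_quadratic: "minexps E = {b \<in> E. mdeg b = 2}"
proof (intro equalityI subsetI)
  fix b assume "b \<in> {b \<in> E. mdeg b = 2}"
  then have b: "b \<in> E" "mdeg b = 2" by auto
  then obtain c where c: "c \<in> minexps E" "\<And>k. Poly_Mapping.lookup c k \<le> Poly_Mapping.lookup b k"
    using minexps_below by blast
  have "c + (b - c) = b"
    by (rule expo_minus_add[OF c(2)])
  moreover from this have "mdeg (b - c) = 0"
    using mdeg_add[of c "b - c"] gen[OF c(1)] b(2) by simp
  ultimately show "b \<in> minexps E"
    using mdeg_eq_0[of "b - c"] c(1) by simp
qed (auto simp: gen minexps_def)

definition pairs :: "(nat \<times> nat) set" where
  "pairs = {(i, j). 1 \<le> i \<and> i \<le> j \<and> j \<le> n \<and> pexp i j \<in> E}"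

lemma minexps_pairs: "minexps E = (\<lambda>(i, j). pexp i j) ` pairs"
proof (intro equalityI subsetI)
  fix b assume "b \<in> minexps E"
  then have "b \<in> E" "mdeg b = 2"
    by (auto simp: minexps_quadratic)
  moreover from this obtain i j where "1 \<le> i" "i \<le> j" "j \<le> n" "b = pexp i j"
    using E_expos by (blast elim: quadratic_exponent)
  ultimately show "b \<in> (\<lambda>(i, j). pexp i j) ` pairs"
    by (force simp: pairs_def)
qed (auto simp: pairs_def minexps_quadratic)

text \<open>The larger variable x_j is the one that stability allows to be replaced;
  \<open>min\<close> and \<open>max\<close> put the new pair back in order.\<close>

lemma pairs_move:
  assumes "(i, j) \<in> pairs" "1 \<le> l" "l < j"
  shows "(min i l, max i l) \<in> pairs"
proof -
  have "pexp i j - Poly_Mapping.single j 1 + Poly_Mapping.single l 1 \<in> E"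
    using stable assms maxvar_pexp[of i j] by (force simp: stable_exps_def pairs_def)
  then have "pexp i l \<in> E"
    by (simp only: pexp_move)
  then show ?thesis
    using assms pexp_commute[of i l] by (auto simp: pairs_def min_def max_def)
qed

text \<open>The pairs that are not the result of a stability move applied to another pair. They are
  the candidates for StaG.\<close>

definition top_pairs :: "(nat \<times> nat) set" where
  "top_pairs = {p \<in> pairs. \<nexists>k l m. (k, l) \<in> pairs \<and> 1 \<le> m \<and> m < l \<and> p = (min k m, max k m)}"

text \<open>Undoing a move never decreases either entry of the ordered pair and strictly increases
  their sum, which is at most 2n. So the maxima of the entries over StaG bound all
  generators.\<close>

lemma top_pairs_above: "(i, j) \<in> pairs \<Longrightarrow> \<exists>(k, l)\<in>top_pairs. i \<le> k \<and> j \<le> l"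
proof (induction "2 * n - (i + j)" arbitrary: i j rule: less_induct)
  case less
  show ?case
  proof (cases "(i, j) \<in> top_pairs")
    case False
    then obtain k l m where m: "(k, l) \<in> pairs" "m < l" "i = min k m" "j = max k m"
      using less.prems by (auto simp: top_pairs_def)
    then have "i \<le> k" "j \<le> l" "i + j < k + l" "k \<le> n" "l \<le> n"
      by (auto simp: pairs_def)
    then have "\<exists>(k', l')\<in>top_pairs. k \<le> k' \<and> l \<le> l'"
      by (intro less.hyps[OF _ m(1)]) linarith
    then obtain k' l' where "(k', l') \<in> top_pairs" "k \<le> k'" "l \<le> l'" by blast
    then show ?thesis
      using \<open>i \<le> k\<close> \<open>j \<le> l\<close> by (intro bexI[of _ "(k', l')"]) auto
  qed auto
qed

text \<open>Read in the other direction, the same descent reaches every pair from a top pair by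
  moves.\<close>

lemma stable_exps_top_pairs:
  assumes E': "stable_exps E'" "\<And>i j. (i, j) \<in> top_pairs \<Longrightarrow> pexp i j \<in> E'"
  shows "(i, j) \<in> pairs \<Longrightarrow> pexp i j \<in> E'"
proof (induction "2 * n - (i + j)" arbitrary: i j rule: less_induct)
  case less
  show ?case
  proof (cases "(i, j) \<in> top_pairs")
    case True
    then show ?thesis by (rule E'(2))
  next
    case False
    then obtain k l m where m: "(k, l) \<in> pairs" "1 \<le> m" "m < l" "i = min k m" "j = max k m"
      using less.prems by (auto simp: top_pairs_def)
    then have kl: "i + j < k + l" "1 \<le> k" "k \<le> l" "l \<le> n"
      by (auto simp: pairs_def)
    then have "pexp k l \<in> E'"
      by (intro less.hyps[OF _ m(1)]) linarith
    then have "pexp k l - Poly_Mapping.single l 1 + Poly_Mapping.single m 1 \<in> E'"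
      using E'(1) m(2,3) maxvar_pexp[OF kl(3)] by (force simp: stable_exps_def)
    then have "pexp k m \<in> E'"
      by (simp only: pexp_move)
    then show ?thesis
      using m(4,5) pexp_commute[of k m] by (simp add: min_def max_def split: if_splits)
  qed
qed

lemma pairs_nonempty: "pairs \<noteq> {}"
  using nonempty minexps_below[of _ E] minexps_pairs by auto

text \<open>A quadratic monomial of \<open>E\<close> that is not a move of another one can be removed from \<open>E\<close> without
  destroying stability, so it belongs to every set that generates \<open>E\<close> as a stable ideal.\<close>

lemma stable_exps_remove:
  assumes t: "(i, j) \<in> top_pairs"
  shows "stable_exps (E - {pexp i j})" and "up n (E - {pexp i j}) = E - {pexp i j}"
proof -
  have ij: "(i, j) \<in> pairs" using t by (simp add: top_pairs_def)
  show "stable_exps (E - {pexp i j})"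
    unfolding stable_exps_def
  proof (intro ballI allI impI)
    fix b m assume b: "b \<in> E - {pexp i j}" and m: "1 \<le> m \<and> m < maxvar b"
    let ?c = "b - Poly_Mapping.single (maxvar b) 1 + Poly_Mapping.single m 1"
    have "?c \<in> E"
      using stable b m by (auto simp: stable_exps_def)
    moreover have "?c \<noteq> pexp i j"
    proof
      assume c: "?c = pexp i j"
      have "b \<noteq> 0"
        using m by (auto simp: maxvar_def)
      then have mk: "maxvar b \<in> Poly_Mapping.keys b"
        using Max_in[of "Poly_Mapping.keys b"] by (simp add: maxvar_def)
      have "Poly_Mapping.single (maxvar b) 1 + (b - Poly_Mapping.single (maxvar b) 1) = b"
        using mk by (intro expo_minus_add) (auto simp: lookup_single when_def in_keys_iff Suc_le_eq)
      \<comment> \<open>Moves preserve degree, so only a quadratic monomial could move to x_i x_j,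
        and a top pair excludes that.\<close>
      then have "mdeg b = mdeg ?c"
        using mdeg_add[of "Poly_Mapping.single (maxvar b) 1" "b - Poly_Mapping.single (maxvar b) 1"]
        by (simp add: mdeg_add)
      then have "mdeg b = 2" by (simp only: c mdeg_pexp)
      then obtain k l where kl: "1 \<le> k" "k \<le> l" "l \<le> n" "b = pexp k l"
        using b E_expos by (blast elim: quadratic_exponent)
      then have "pexp k m = pexp i j"
        using c by (simp only: maxvar_pexp pexp_move)
      then have "pexp (min k m) (max k m) = pexp i j"
        using pexp_commute[of k m] by (simp add: min_def max_def)
      then have "(i, j) = (min k m, max k m)"
        using ij by (subst (asm) pexp_eq_iff) (auto simp: pairs_def)
      moreover have "(k, l) \<in> pairs" "m < l"
        using kl b m by (auto simp: pairs_def maxvar_pexp)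
      ultimately show False
        using t m unfolding top_pairs_def by blast
    qed
    ultimately show "?c \<in> E - {pexp i j}" by simp
  qed
  show "up n (E - {pexp i j}) = E - {pexp i j}"
  proof
    show "E - {pexp i j} \<subseteq> up n (E - {pexp i j})"
      using E_expos by (intro up_self) auto
    have "up n (E - {pexp i j}) \<subseteq> up n E"
      by (auto simp: up_def)
    \<comment> \<open>As a minimal generator, x_i x_j is divisible by no other monomial of
      \<open>E\<close>.\<close>
    moreover have "pexp i j \<notin> up n (E - {pexp i j})"
    proof
      assume "pexp i j \<in> up n (E - {pexp i j})"
      then obtain c where "c \<in> E" "c \<noteq> pexp i j" "\<forall>k. Poly_Mapping.lookup c k \<le> Poly_Mapping.lookup (pexp i j) k"
        by (auto simp: up_def)
      moreover have "pexp i j \<in> minexps E"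
        using ij minexps_pairs by auto
      ultimately show False by (auto simp: minexps_def)
    qed
    ultimately show "up n (E - {pexp i j}) \<subseteq> E - {pexp i j}"
      using up by blast
  qed
qed

text \<open>The top pairs generate by descent. None can be missing from a generating set, since
  \<open>E\<close> without that monomial would be a smaller stable ideal containing the set.\<close>

lemma StaG_polys_on:
  "StaG n (polys_on E :: 'k::field mpol set) = xmon ` (\<lambda>(i, j). pexp i j) ` top_pairs"
  unfolding StaG_def
proof (rule Least_equality)
  let ?T = "xmon ` (\<lambda>(i, j). pexp i j) ` top_pairs :: 'k mpol set"
  have T: "?T \<subseteq> monomials n"
    by (auto simp: monomials_def top_pairs_def pairs_def intro!: pexp_expos)
  have st: "stable_ideal n (polys_on E :: 'k mpol set)"
    using stable_ideal_polys_on[of n E] stable up by simp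
  have TE: "?T \<subseteq> polys_on E"
    by (auto simp: xmon_in_polys_on top_pairs_def pairs_def)
  obtain B where B: "Sta n ?T = polys_on (up n B)"
    using Sta_properties(1)[OF T] by (auto simp: stable_ideal_def monomial_ideal_iff)
  have "pexp i j \<in> up n B" if "(i, j) \<in> pairs" for i j
  proof (rule stable_exps_top_pairs[OF _ _ that])
    show "stable_exps (up n B)"
      using Sta_properties(1)[OF T] by (simp add: B stable_ideal_polys_on)
    show "pexp i j \<in> up n B" if "(i, j) \<in> top_pairs" for i j
    proof -
      have "xmon (pexp i j) \<in> ?T" using that by blast
      then show ?thesis
        using Sta_properties(2)[OF T] B xmon_in_polys_on by blast
    qed
  qed
  then have "minexps E \<subseteq> up n B"
    by (auto simp: minexps_pairs)
  then have "up n (minexps E) \<subseteq> up n (up n B)"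
    by (rule up_mono)
  then have "E \<subseteq> up n B"
    using up_minexps[of n E] up by simp
  then have "polys_on E \<subseteq> Sta n ?T"
    unfolding B by (rule polys_on_mono)
  moreover have "Sta n ?T \<subseteq> polys_on E"
    by (rule Sta_properties(3)[OF T st TE])
  moreover have "?T \<noteq> {}"
    using pairs_nonempty top_pairs_above by fastforce
  ultimately show "?T \<subseteq> monomials n \<and> ?T \<noteq> {} \<and> Sta n ?T = polys_on E"
    using T by blast
next
  fix T :: "'k mpol set"
  assume "T \<subseteq> monomials n \<and> T \<noteq> {} \<and> Sta n T = polys_on E"
  then have T: "T \<subseteq> monomials n" "Sta n T = polys_on E" by auto
  have "xmon (pexp i j) \<in> T" if t: "(i, j) \<in> top_pairs" for i j
  proof (rule ccontr)
    assume notin: "xmon (pexp i j) \<notin> T"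
    let ?E = "E - {pexp i j}"
    have "T \<subseteq> polys_on ?E"
    proof
      fix x assume x: "x \<in> T"
      then obtain b where b: "x = xmon b"
        using T(1) by (auto simp: monomials_def)
      moreover have "x \<in> polys_on E"
        using x Sta_properties(2)[OF T(1)] T(2) by blast
      ultimately show "x \<in> polys_on ?E"
        using notin x by (auto simp: xmon_in_polys_on)
    qed
    moreover have "stable_ideal n (polys_on ?E :: 'k mpol set)"
      using stable_ideal_polys_on[of n ?E] stable_exps_remove[OF t] by simp
    ultimately have "polys_on E \<subseteq> (polys_on ?E :: 'k mpol set)"
      using Sta_properties(3)[OF T(1)] T(2) by metis
    moreover have "xmon (pexp i j) \<in> (polys_on E :: 'k mpol set)"
      using t by (simp add: xmon_in_polys_on top_pairs_def pairs_def)
    ultimately have "xmon (pexp i j) \<in> (polys_on ?E :: 'k mpol set)"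
      by blast
    then show False
      by (simp add: xmon_in_polys_on)
  qed
  then show "xmon ` (\<lambda>(i, j). pexp i j) ` top_pairs \<subseteq> T"
    by auto
qed

end


section \<open>Dual ideals of sets of quadratic monomials\<close>

definition dual_ideal :: "nat \<Rightarrow> expo \<Rightarrow> (nat \<times> nat) set \<Rightarrow> 'k::field mpol set" where
  "dual_ideal n a S = polys_on (up n ((\<lambda>(i, j). a - pexp i j) ` S))"

text \<open>Position 0 is the ring, so the ranks at positions 2 and 3 are the Betti numbers with
  index 1 and 2 of the ideal.\<close>

definition lin_betti :: "nat \<Rightarrow> int \<Rightarrow> 'k::field mpol set \<Rightarrow> nat \<Rightarrow> nat \<Rightarrow> bool" where
  "lin_betti n d J x y \<longleftrightarrow> (\<exists>\<rho>. lin_res n d J \<rho> \<and> \<rho> 2 = x \<and> \<rho> 3 = y)"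

text \<open>Divisibility of x^a by x_i x_j makes the truncated difference
  \<open>a - pexp i j\<close> the true exponent of the quotient.\<close>

definition fits :: "nat \<Rightarrow> expo \<Rightarrow> nat \<times> nat \<Rightarrow> bool" where
  "fits n a = (\<lambda>(i, j). 1 \<le> i \<and> i \<le> j \<and> j \<le> n \<and>
     (\<forall>t. Poly_Mapping.lookup (pexp i j) t \<le> Poly_Mapping.lookup a t))"

text \<open>The colon ideal of $x^{\mathbf a}/(x_kx_l)$ by $x^{\mathbf a}/(x_ix_j)$ consists of the \<open>f\<close> with
  $x_ix_j \mid f x_kx_l$.\<close>

lemma dual_colon:
  assumes a: "a \<in> expos n" and ij: "fits n a (i, j)" and S: "\<And>p. p \<in> S \<Longrightarrow> fits n a p" and b: "b \<in> expos n"
  shows "(a - pexp i j) + b \<in> up n ((\<lambda>(i, j). a - pexp i j) ` S) \<longleftrightarrow>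
    (\<exists>(k, l)\<in>S. \<forall>t. Poly_Mapping.lookup (pexp i j) t \<le> Poly_Mapping.lookup b t + Poly_Mapping.lookup (pexp k l) t)"
proof -
  have "(\<forall>t. Poly_Mapping.lookup (a - pexp k l) t \<le> Poly_Mapping.lookup ((a - pexp i j) + b) t) \<longleftrightarrow>
      (\<forall>t. Poly_Mapping.lookup (pexp i j) t \<le> Poly_Mapping.lookup b t + Poly_Mapping.lookup (pexp k l) t)"
    if kl: "(k, l) \<in> S" for k l
  proof (intro arg_cong[where f = All] ext)
    fix t
    \<comment> \<open>Both subtractions from \<open>a\<close> are exact, so the two inequalities
      differ only by rearranging terms.\<close>
    have "Poly_Mapping.lookup (pexp k l) t \<le> Poly_Mapping.lookup a t"
        "Poly_Mapping.lookup (pexp i j) t \<le> Poly_Mapping.lookup a t"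
      using S[OF kl] ij by (auto simp: fits_def)
    then show "Poly_Mapping.lookup (a - pexp k l) t \<le> Poly_Mapping.lookup ((a - pexp i j) + b) t \<longleftrightarrow>
        Poly_Mapping.lookup (pexp i j) t \<le> Poly_Mapping.lookup b t + Poly_Mapping.lookup (pexp k l) t"
      unfolding lookup_add lookup_minus by linarith
  qed
  note eq = this
  have "(a - pexp i j) + b \<in> expos n"
    using a b by (intro expos_add expos_minus)
  then have "(a - pexp i j) + b \<in> up n ((\<lambda>(i, j). a - pexp i j) ` S) \<longleftrightarrow>
      (\<exists>p\<in>S. \<forall>t. Poly_Mapping.lookup (case p of (k, l) \<Rightarrow> a - pexp k l) t \<le> Poly_Mapping.lookup ((a - pexp i j) + b) t)"
    by (simp add: up_def)
  also have "\<dots> \<longleftrightarrow> (\<exists>(k, l)\<in>S. \<forall>t.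
      Poly_Mapping.lookup (pexp i j) t \<le> Poly_Mapping.lookup b t + Poly_Mapping.lookup (pexp k l) t)"
  proof (rule bex_cong[OF refl])
    fix p assume "p \<in> S"
    then show "(\<forall>t. Poly_Mapping.lookup (case p of (k, l) \<Rightarrow> a - pexp k l) t \<le> Poly_Mapping.lookup ((a - pexp i j) + b) t) \<longleftrightarrow>
        (case p of (k, l) \<Rightarrow> \<forall>t. Poly_Mapping.lookup (pexp i j) t \<le> Poly_Mapping.lookup b t + Poly_Mapping.lookup (pexp k l) t)"
      using eq by (cases p) simp
  qed
  finally show ?thesis .
qed

text \<open>The cone places position \<open>i\<close> of the colon resolution at
  \<open>i + 1\<close>, so \<open>\<kappa> 1\<close> and \<open>\<kappa> 2\<close> are added to the
  ranks at positions 2 and 3.\<close>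

lemma lin_betti_insert:
  assumes a: "a \<in> expos n" and ij: "fits n a (i, j)" and S: "\<And>p. p \<in> S \<Longrightarrow> fits n a p"
    and J: "lin_betti n (int (mdeg a) - 2) (dual_ideal n a S :: 'k::field mpol set) x y"
    and L: "lin_res n 1 (polys_on C :: 'k mpol set) \<kappa>"
    and C: "\<And>b. b \<in> expos n \<Longrightarrow> b \<in> C \<longleftrightarrow> (\<exists>(k, l)\<in>S. \<forall>t.
      Poly_Mapping.lookup (pexp i j) t \<le> Poly_Mapping.lookup b t + Poly_Mapping.lookup (pexp k l) t)"
  shows "lin_betti n (int (mdeg a) - 2) (dual_ideal n a (insert (i, j) S) :: 'k mpol set) (x + \<kappa> 1) (y + \<kappa> 2)"
proof -
  obtain \<rho> where \<rho>: "lin_res n (int (mdeg a) - 2) (dual_ideal n a S :: 'k mpol set) \<rho>" "\<rho> 2 = x" "\<rho> 3 = y"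
    using J by (auto simp: lin_betti_def)
  have "pexp i j + (a - pexp i j) = a"
    using ij by (intro expo_minus_add) (auto simp: fits_def)
  then have "2 + mdeg (a - pexp i j) = mdeg a"
    using mdeg_add[of "pexp i j" "a - pexp i j"] by simp
  then have "int (mdeg (a - pexp i j)) = int (mdeg a) - 2"
    by linarith
  then have "lin_res n (int (mdeg a) - 2)
      (polys_on (up n (insert (a - pexp i j) ((\<lambda>(i, j). a - pexp i j) ` S))) :: 'k mpol set)
      (\<lambda>i. case i of 0 \<Rightarrow> 1 | Suc i' \<Rightarrow> \<rho> i + \<kappa> i')"
    using \<rho>(1) C dual_colon[OF a ij S]
    by (intro lin_res_insert[OF _ L expos_minus[OF a]]) (auto simp: dual_ideal_def)
  then show ?thesis
    unfolding lin_betti_def dual_ideal_def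
    by (intro exI[of _ "\<lambda>i. case i of 0 \<Rightarrow> 1 | Suc i' \<Rightarrow> \<rho> i + \<kappa> i'"])
      (use \<rho>(2,3) in \<open>simp add: numeral_2_eq_2 numeral_3_eq_3\<close>)
qed

lemma lin_betti_insert_one_var:
  assumes a: "a \<in> expos n" and ij: "fits n a (i, j)" and S: "\<And>p. p \<in> S \<Longrightarrow> fits n a p"
    and J: "lin_betti n (int (mdeg a) - 2) (dual_ideal n a S :: 'k::field mpol set) x y"
    and C: "\<And>b. (\<exists>(k, l)\<in>S. \<forall>t. Poly_Mapping.lookup (pexp i j) t
      \<le> Poly_Mapping.lookup b t + Poly_Mapping.lookup (pexp k l) t) \<longleftrightarrow> Poly_Mapping.lookup b j \<ge> 1"
  shows "lin_betti n (int (mdeg a) - 2) (dual_ideal n a (insert (i, j) S) :: 'k mpol set) (x + 1) y"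
proof -
  have "1 \<le> j" "j \<le> n" using ij by (auto simp: fits_def)
  from lin_betti_insert[OF a ij S J lin_res_var[OF this]] show ?thesis
    using C by simp
qed

lemma lin_betti_insert_two_vars:
  assumes a: "a \<in> expos n" and ij: "fits n a (i, j)" and S: "\<And>p. p \<in> S \<Longrightarrow> fits n a p" and "i \<noteq> j"
    and J: "lin_betti n (int (mdeg a) - 2) (dual_ideal n a S :: 'k::field mpol set) x y"
    and C: "\<And>b. (\<exists>(k, l)\<in>S. \<forall>t. Poly_Mapping.lookup (pexp i j) t
      \<le> Poly_Mapping.lookup b t + Poly_Mapping.lookup (pexp k l) t) \<longleftrightarrow>
      Poly_Mapping.lookup b i \<ge> 1 \<or> Poly_Mapping.lookup b j \<ge> 1"
  shows "lin_betti n (int (mdeg a) - 2) (dual_ideal n a (insert (i, j) S) :: 'k mpol set) (x + 2) (y + 1)"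
proof -
  have "1 \<le> i" "i \<le> n" "1 \<le> j" "j \<le> n" using ij by (auto simp: fits_def)
  from lin_betti_insert[OF a ij S J lin_res_two_vars[OF this \<open>i \<noteq> j\<close>]] show ?thesis
    using C by (simp add: numeral_2_eq_2)
qed

text \<open>Within a new column \<open>j\<close>, the first generator has colon ideal $(x_j)$, every further generator
  $x_ix_j$ with \<open>i < j\<close> has colon ideal $(x_i, x_j)$.\<close>

lemma lin_betti_column:
  assumes a: "a \<in> expos n" and S: "\<And>p. p \<in> S \<Longrightarrow> fits n a p" "\<And>k l. (k, l) \<in> S \<Longrightarrow> l < j"
    and J: "lin_betti n (int (mdeg a) - 2) (dual_ideal n a S :: 'k::field mpol set) x y"
    and Y: "finite Y" "Y \<noteq> {}" "\<And>i. i \<in> Y \<Longrightarrow> fits n a (i, j) \<and> i < j \<and> (1, i) \<in> S"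
  shows "lin_betti n (int (mdeg a) - 2) (dual_ideal n a ((\<lambda>i. (i, j)) ` Y \<union> S) :: 'k mpol set)
    (x + 2 * card Y - 1) (y + card Y - 1)"
  using Y
proof (induction Y rule: finite_ne_induct)
  case (singleton i)
  then have i: "fits n a (i, j)" "i < j" "(1, i) \<in> S" by auto
  have "(\<exists>(k, l)\<in>S. \<forall>t. Poly_Mapping.lookup (pexp i j) t
      \<le> Poly_Mapping.lookup b t + Poly_Mapping.lookup (pexp k l) t) \<longleftrightarrow> Poly_Mapping.lookup b j \<ge> 1" for b
  proof
    assume "\<exists>(k, l)\<in>S. \<forall>t. Poly_Mapping.lookup (pexp i j) t
      \<le> Poly_Mapping.lookup b t + Poly_Mapping.lookup (pexp k l) t"
    then obtain k l where kl: "(k, l) \<in> S" "\<And>t. Poly_Mapping.lookup (pexp i j) t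
      \<le> Poly_Mapping.lookup b t + Poly_Mapping.lookup (pexp k l) t" by blast
    have "k \<le> l" "l < j" using S kl(1) by (auto simp: fits_def)
    then show "Poly_Mapping.lookup b j \<ge> 1"
      using kl(2)[of j] by (simp add: lookup_pexp)
  next
    \<comment> \<open>The witness is (1, i): it already supplies x_i, so only x_j has to come from
      \<open>b\<close>.\<close>
    assume "Poly_Mapping.lookup b j \<ge> 1"
    then have "\<forall>t. Poly_Mapping.lookup (pexp i j) t \<le> Poly_Mapping.lookup b t + Poly_Mapping.lookup (pexp 1 i) t"
      by (simp add: lookup_pexp)
    then show "\<exists>(k, l)\<in>S. \<forall>t. Poly_Mapping.lookup (pexp i j) t
      \<le> Poly_Mapping.lookup b t + Poly_Mapping.lookup (pexp k l) t"
      using i(3) by blast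
  qed
  from lin_betti_insert_one_var[OF a i(1) S(1) J this] show ?case
    by simp
next
  case (insert i Y)
  let ?S = "(\<lambda>i. (i, j)) ` Y \<union> S"
  have i: "fits n a (i, j)" "i < j" "(1, i) \<in> S"
    using insert.prems by auto
  obtain i' where i': "i' \<in> Y" using insert.hyps(2) by blast
  have S': "fits n a p" if "p \<in> ?S" for p
    using that S(1)[of p] insert.prems by auto
  have C: "(\<exists>(k, l)\<in>?S. \<forall>t. Poly_Mapping.lookup (pexp i j) t
      \<le> Poly_Mapping.lookup b t + Poly_Mapping.lookup (pexp k l) t) \<longleftrightarrow>
      Poly_Mapping.lookup b i \<ge> 1 \<or> Poly_Mapping.lookup b j \<ge> 1" for b
  proof
    assume "\<exists>(k, l)\<in>?S. \<forall>t. Poly_Mapping.lookup (pexp i j) t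
      \<le> Poly_Mapping.lookup b t + Poly_Mapping.lookup (pexp k l) t"
    then obtain k l where kl: "(k, l) \<in> ?S" "\<And>t. Poly_Mapping.lookup (pexp i j) t
      \<le> Poly_Mapping.lookup b t + Poly_Mapping.lookup (pexp k l) t" by blast
    show "Poly_Mapping.lookup b i \<ge> 1 \<or> Poly_Mapping.lookup b j \<ge> 1"
    proof (cases "(k, l) \<in> S")
      case True
      then have "k \<le> l" "l < j" using S by (auto simp: fits_def)
      then show ?thesis
        using kl(2)[of j] by (simp add: lookup_pexp)
    next
      case False
      then have "k \<noteq> i" "l = j" using kl(1) insert.hyps(3) by auto
      then show ?thesis
        using kl(2)[of i] i(2) by (simp add: lookup_pexp)
    qed
  next
    assume "Poly_Mapping.lookup b i \<ge> 1 \<or> Poly_Mapping.lookup b j \<ge> 1"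
    \<comment> \<open>A factor x_i of \<open>b\<close> is completed by (i', j) from the same column,
      a factor x_j by (1, i) from an earlier one.\<close>
    then have "(\<forall>t. Poly_Mapping.lookup (pexp i j) t \<le> Poly_Mapping.lookup b t + Poly_Mapping.lookup (pexp i' j) t) \<or>
        (\<forall>t. Poly_Mapping.lookup (pexp i j) t \<le> Poly_Mapping.lookup b t + Poly_Mapping.lookup (pexp 1 i) t)"
      by (auto simp: lookup_pexp)
    moreover have "(i', j) \<in> ?S" "(1, i) \<in> ?S"
      using i' i(3) by auto
    ultimately show "\<exists>(k, l)\<in>?S. \<forall>t. Poly_Mapping.lookup (pexp i j) t
      \<le> Poly_Mapping.lookup b t + Poly_Mapping.lookup (pexp k l) t"
      by blast
  qed
  have ne: "i \<noteq> j" using i(2) by simp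
  have IH: "lin_betti n (int (mdeg a) - 2) (dual_ideal n a ?S :: 'k mpol set) (x + 2 * card Y - 1) (y + card Y - 1)"
    using insert by blast
  \<comment> \<open>Needed for the natural-number subtractions in the counts to be exact.\<close>
  have "card Y > 0" using insert.hyps by (simp add: card_gt_0_iff)
  then have "x + 2 * card Y - 1 + 2 = x + 2 * card (insert i Y) - 1"
      "y + card Y - 1 + 1 = y + card (insert i Y) - 1"
    using insert.hyps by auto
  then show ?case
    using lin_betti_insert_two_vars[OF a i(1) S' ne IH C] by simp
qed

text \<open>Every earlier pair contains x_j at most once, so each quotient is divisible by x_j, and
  x_i x_j attains x_j itself.\<close>

lemma lin_betti_square:
  assumes a: "a \<in> expos n" and S: "\<And>p. p \<in> S \<Longrightarrow> fits n a p" "\<And>k l. (k, l) \<in> S \<Longrightarrow> k < j" "(i, j) \<in> S"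
    and J: "lin_betti n (int (mdeg a) - 2) (dual_ideal n a S :: 'k::field mpol set) x y"
    and j: "fits n a (j, j)" "\<And>k l. (k, l) \<in> S \<Longrightarrow> l \<le> j"
  shows "lin_betti n (int (mdeg a) - 2) (dual_ideal n a (insert (j, j) S) :: 'k mpol set) (x + 1) y"
proof (rule lin_betti_insert_one_var[OF a j(1) S(1) J])
  fix b
  show "(\<exists>(k, l)\<in>S. \<forall>t. Poly_Mapping.lookup (pexp j j) t
      \<le> Poly_Mapping.lookup b t + Poly_Mapping.lookup (pexp k l) t) \<longleftrightarrow> Poly_Mapping.lookup b j \<ge> 1"
  proof
    assume "\<exists>(k, l)\<in>S. \<forall>t. Poly_Mapping.lookup (pexp j j) t
      \<le> Poly_Mapping.lookup b t + Poly_Mapping.lookup (pexp k l) t"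
    then obtain k l where kl: "(k, l) \<in> S" "\<And>t. Poly_Mapping.lookup (pexp j j) t
      \<le> Poly_Mapping.lookup b t + Poly_Mapping.lookup (pexp k l) t" by blast
    show "Poly_Mapping.lookup b j \<ge> 1"
      using kl(2)[of j] S(2)[OF kl(1)] by (simp add: lookup_pexp split: if_splits)
  next
    assume "Poly_Mapping.lookup b j \<ge> 1"
    then have "\<forall>t. Poly_Mapping.lookup (pexp j j) t \<le> Poly_Mapping.lookup b t + Poly_Mapping.lookup (pexp i j) t"
      by (simp add: lookup_pexp)
    then show "\<exists>(k, l)\<in>S. \<forall>t. Poly_Mapping.lookup (pexp j j) t
      \<le> Poly_Mapping.lookup b t + Poly_Mapping.lookup (pexp k l) t"
      using S(3) by blast
  qed
qed

section \<open>Counting the contributions of the columns\<close>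

context
  fixes n :: nat and a :: expo and P :: "(nat \<times> nat) set" and h e :: nat and Y :: "nat \<Rightarrow> nat set"
  assumes a: "a \<in> expos n" and P: "\<And>p. p \<in> P \<Longrightarrow> fits n a p"
    and triangle: "\<And>i j. 1 \<le> i \<Longrightarrow> i \<le> j \<Longrightarrow> j \<le> h \<Longrightarrow> (i, j) \<in> P"
    and he: "1 \<le> h" "h \<le> e" and bound: "\<And>i j. (i, j) \<in> P \<Longrightarrow> i \<le> h \<and> j \<le> e"
    and Y: "\<And>j. Y j = {i. (i, j) \<in> P}" "\<And>j. h < j \<Longrightarrow> j \<le> e \<Longrightarrow> Y j \<noteq> {}"
begin

text \<open>Column l >= 2 contributes one colon ideal on one variable for its first member, l - 2 on
  two variables, and one on one variable for its square.\<close>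

lemma lin_betti_triangle:
  assumes "1 \<le> j" "j \<le> h"
  shows "\<exists>x y. lin_betti n (int (mdeg a) - 2) (dual_ideal n a {(k, l) \<in> P. l \<le> j} :: 'k::field mpol set) x y \<and>
    int y = (\<Sum>l=2..j. int l - 2) \<and> int x = 2 * int y + 2 * (int j - 1)"
  using assms
proof (induction j rule: dec_induct)
  case base
  have P1: "{(k, l) \<in> P. l \<le> 1} = {(1, 1)}"
    using triangle[of 1 1] he P by (fastforce simp: fits_def)
  have "lin_betti n (int (mdeg a) - 2) (dual_ideal n a {} :: 'k mpol set) 0 0"
    unfolding lin_betti_def dual_ideal_def
    by (intro exI[of _ "\<lambda>i. if i = 0 then 1 else 0"]) (use lin_res_empty in \<open>simp add: up_def\<close>)
  \<comment> \<open>With nothing before x_1^2 its colon ideal is 0, so it adds nothing at positions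
    2 and 3.\<close>
  from lin_betti_insert[OF a _ _ this lin_res_empty, of 1 1]
  have "lin_betti n (int (mdeg a) - 2) (dual_ideal n a {(1, 1)} :: 'k mpol set) 0 0"
    using P triangle[of 1 1] he by auto
  then show ?case
    unfolding P1 by (intro exI[of _ 0]) simp
next
  case (step j)
  let ?S = "{(k, l) \<in> P. l \<le> j}"
  obtain x y where xy: "lin_betti n (int (mdeg a) - 2) (dual_ideal n a ?S :: 'k mpol set) x y"
      "int y = (\<Sum>l=2..j. int l - 2)" "int x = 2 * int y + 2 * (int j - 1)"
    using step by auto
  have col: "lin_betti n (int (mdeg a) - 2) (dual_ideal n a ((\<lambda>i. (i, Suc j)) ` {1..j} \<union> ?S) :: 'k mpol set)
      (x + 2 * card {1..j} - 1) (y + card {1..j} - 1)"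
    using step.hyps step.prems P triangle
    by (intro lin_betti_column[OF a _ _ xy(1)]) auto
  let ?S' = "(\<lambda>i. (i, Suc j)) ` {1..j} \<union> ?S"
  have "lin_betti n (int (mdeg a) - 2) (dual_ideal n a (insert (Suc j, Suc j) ?S') :: 'k mpol set)
      (x + 2 * card {1..j} - 1 + 1) (y + card {1..j} - 1)"
  proof (rule lin_betti_square[OF a _ _ _ col, of _ 1])
    show "fits n a p" if "p \<in> ?S'" for p
      using that step.prems P triangle by auto
    show "k < Suc j" if "(k, l) \<in> ?S'" for k l
      using that P[of "(k, l)"] by (auto simp: fits_def)
    show "(1, Suc j) \<in> ?S'"
      using step.hyps by auto
    show "fits n a (Suc j, Suc j)"
      using step.prems P triangle by auto
  qed auto
  moreover have "insert (Suc j, Suc j) ?S' = {(k, l) \<in> P. l \<le> Suc j}"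
  proof -
    have col: "(k, Suc j) \<in> P \<longleftrightarrow> k = Suc j \<or> 1 \<le> k \<and> k \<le> j" for k
    proof
      assume "(k, Suc j) \<in> P"
      then show "k = Suc j \<or> 1 \<le> k \<and> k \<le> j"
        using P[of "(k, Suc j)"] by (simp add: fits_def) linarith
    next
      assume "k = Suc j \<or> 1 \<le> k \<and> k \<le> j"
      then show "(k, Suc j) \<in> P"
        using step.prems by (intro triangle) auto
    qed
    have "(k, l) \<in> insert (Suc j, Suc j) ?S' \<longleftrightarrow> (k, l) \<in> {(k, l) \<in> P. l \<le> Suc j}" for k l
      by (cases "l = Suc j") (auto simp: col)
    then show ?thesis by (simp only: set_eq_iff split_paired_All) simp
  qed
  moreover have "{2..Suc j} = insert (Suc j) {2..j}"
    using step.hyps by auto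
  ultimately show ?case
    using xy(2,3) step.hyps
    by (intro exI[of _ "x + 2 * card {1..j} - 1 + 1"] exI[of _ "y + card {1..j} - 1"]) auto
qed

text \<open>Beyond column h there are no squares, so each column contributes a single colon ideal on
  one variable and |Y_l| - 1 on two.\<close>

lemma lin_betti_columns:
  assumes "h \<le> j" "j \<le> e"
  shows "\<exists>x y. lin_betti n (int (mdeg a) - 2) (dual_ideal n a {(k, l) \<in> P. l \<le> j} :: 'k::field mpol set) x y \<and>
    int y = (\<Sum>l=2..h. int l - 2) + (\<Sum>l=h+1..j. int (card (Y l)) - 1) \<and>
    int x = 2 * int y + 2 * (int h - 1) + (int j - int h)"
  using assms
proof (induction j rule: dec_induct)
  case base
  have "(\<Sum>l=h+1..h. int (card (Y l)) - 1) = 0" by simp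
  then show ?case
    using lin_betti_triangle[OF he(1) order_refl, where 'k = 'k] by simp
next
  case (step j)
  let ?S = "{(k, l) \<in> P. l \<le> j}"
  obtain x y where xy: "lin_betti n (int (mdeg a) - 2) (dual_ideal n a ?S :: 'k mpol set) x y"
      "int y = (\<Sum>l=2..h. int l - 2) + (\<Sum>l=h+1..j. int (card (Y l)) - 1)"
      "int x = 2 * int y + 2 * (int h - 1) + (int j - int h)"
    using step by auto
  have Yj: "i \<in> Y (Suc j) \<Longrightarrow> 1 \<le> i \<and> i \<le> h" for i
    using P bound by (fastforce simp: Y fits_def)
  then have fin: "finite (Y (Suc j))"
    by (meson finite_atMost finite_subset atMost_iff subsetI)
  have ne: "Y (Suc j) \<noteq> {}"
    using Y(2)[of "Suc j"] step by simp
  have "lin_betti n (int (mdeg a) - 2) (dual_ideal n a ((\<lambda>i. (i, Suc j)) ` Y (Suc j) \<union> ?S) :: 'k mpol set)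
      (x + 2 * card (Y (Suc j)) - 1) (y + card (Y (Suc j)) - 1)"
  proof (rule lin_betti_column[OF a _ _ xy(1) fin ne])
    \<comment> \<open>The triangle supplies (1, i), since the members of \<open>Y (Suc j)\<close>
      are at most h.\<close>
    show "fits n a (i, Suc j) \<and> i < Suc j \<and> (1, i) \<in> ?S" if "i \<in> Y (Suc j)" for i
      using that Yj[OF that] step.hyps P triangle[of 1 i] by (auto simp: Y)
  qed (use P in auto)
  moreover have "(\<lambda>i. (i, Suc j)) ` Y (Suc j) \<union> ?S = {(k, l) \<in> P. l \<le> Suc j}"
    by (auto simp: Y le_Suc_eq)
  moreover have "{h+1..Suc j} = insert (Suc j) {h+1..j}"
    using step.hyps by auto
  moreover have "card (Y (Suc j)) \<ge> 1"
    using fin ne by (simp add: Suc_le_eq card_gt_0_iff)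
  ultimately show ?case
    using xy(2,3) step.hyps
    by (intro exI[of _ "x + 2 * card (Y (Suc j)) - 1"] exI[of _ "y + card (Y (Suc j)) - 1"]) auto
qed

end

theorem mainTheorem8:
  fixes n g :: nat
    and a :: expo
    and I :: "('k::field mpol) set"
    and k1 k2 :: "nat \<Rightarrow> nat"
    and h e :: nat
    and Y :: "nat \<Rightarrow> nat set"
    and w1 w2 :: int
  assumes "a \<in> expos n"
    and "stable_ideal n I"
    and "I \<noteq> {0}"
    and "generated_in_degree n I 2"
    and "determined n a I"
    and "StaG n I = {xvar (k1 k) * xvar (k2 k) | k. 1 \<le> k \<and> k \<le> g}"
    and "\<And>k. 1 \<le> k \<Longrightarrow> k \<le> g \<Longrightarrow> 1 \<le> k1 k \<and> k1 k \<le> k2 k \<and> k2 k \<le> n"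
    and "h = Max {k1 k | k. 1 \<le> k \<and> k \<le> g}"
    and "e = Max {k2 k | k. 1 \<le> k \<and> k \<le> g}"
    and "\<And>j. j \<in> {1..n} \<Longrightarrow> Y j = {i \<in> {1..j}. xvar i * xvar j \<in> mgens n I}"
    and "w2 = (\<Sum>j=2..h. int j - 2) + (\<Sum>j=h+1..e. int (card (Y j)) - 1)"
    and "w1 = 2 * (int h - 1) + (int e - int h)"
  shows "\<forall>i\<in>{1, 2}. int (betti_ideal n (adual n a I) i)
           = w2 * int (2 choose i) + w1 * int (1 choose i)"
proof -
  obtain B where I: "I = polys_on (up n B)"
    using assms(2) by (auto simp: stable_ideal_def monomial_ideal_iff)
  define E where "E = up n B"
  have up: "up n E = E" by (simp add: E_def)
  have IE: "I = polys_on E" by (simp add: I E_def)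
  have mg: "mgens n I = xmon ` minexps E"
    by (simp add: I E_def mgens_polys_on)
  have gen: "mdeg b = 2" if "b \<in> minexps E" for b
    using assms(4) that by (simp add: generated_in_degree_def mg)
  have stable: "stable_exps E"
    using assms(2) by (simp add: I E_def stable_ideal_polys_on)
  have ne: "E \<noteq> {}"
    using assms(3) by (auto simp: IE polys_on_def)
  note ctxt = up gen stable ne
  let ?P = "pairs n E" and ?T = "top_pairs n E"
  have TP: "?T \<subseteq> ?P"
    by (auto simp: top_pairs_def[OF ctxt])
  have mgP: "xvar i * xvar j \<in> mgens n I \<longleftrightarrow> (i, j) \<in> ?P" if "i \<le> j" for i j
  proof -
    have "xvar i * xvar j \<in> mgens n I \<longleftrightarrow> pexp i j \<in> (\<lambda>(i, j). pexp i j) ` ?P"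
      by (simp add: mg xvar_mult_xvar xmon_mem_image minexps_pairs[OF ctxt])
    also have "\<dots> \<longleftrightarrow> (i, j) \<in> ?P"
      using that pexp_eq_iff by (force simp: pairs_def[OF ctxt])
    finally show ?thesis .
  qed
  define K where "K = {1..g}"
  have T: "?T = (\<lambda>k. (k1 k, k2 k)) ` K"
  proof -
    have "(xmon ` (\<lambda>(i, j). pexp i j) ` ?T :: 'k mpol set) = StaG n I"
      by (simp only: IE StaG_polys_on[OF ctxt])
    also have "\<dots> = xmon ` (\<lambda>k. pexp (k1 k) (k2 k)) ` K"
      unfolding assms(6) K_def by (auto simp: xvar_mult_xvar)
    finally have "(xmon ` (\<lambda>(i, j). pexp i j) ` ?T :: 'k mpol set) = xmon ` (\<lambda>k. pexp (k1 k) (k2 k)) ` K" .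
    then have "(\<lambda>(i, j). pexp i j) ` ?T = (\<lambda>k. pexp (k1 k) (k2 k)) ` K"
      by (rule inj_image_eq_iff[OF inj_xmon, THEN iffD1])
    then have eq: "(\<lambda>(i, j). pexp i j) ` ?T = (\<lambda>(i, j). pexp i j) ` (\<lambda>k. (k1 k, k2 k)) ` K"
      by (simp add: image_image)
    \<comment> \<open>Injectivity holds on ordered pairs only, which is why both sides must consist
      of pairs with i <= j.\<close>
    have inj: "inj_on (\<lambda>(i, j). pexp i j) {(i, j). i \<le> j}"
      by (auto simp: inj_on_def pexp_eq_iff)
    show ?thesis
      using inj_on_image_eq_iff[OF inj, of ?T "(\<lambda>k. (k1 k, k2 k)) ` K"] eq TP assms(7)
      by (force simp: pairs_def[OF ctxt] K_def)
  qed
  have Kne: "K \<noteq> {}"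
    using T pairs_nonempty[OF ctxt] top_pairs_above[OF ctxt] by fastforce
  have h: "h = Max (k1 ` K)" and e: "e = Max (k2 ` K)"
    using assms(8,9) by (simp_all add: K_def setcompr_eq_image atLeastAtMost_def atLeast_def atMost_def Int_def)
  have fin: "finite K" by (simp add: K_def)
  have "h \<in> k1 ` K" "e \<in> k2 ` K"
    unfolding h e using fin Kne by (simp_all add: Max_in)
  then obtain kh ke where kh: "kh \<in> K" "k1 kh = h" and ke: "ke \<in> K" "k2 ke = e"
    by blast
  have KP: "(k1 k, k2 k) \<in> ?P" if "k \<in> K" for k
    using that T TP by blast
  have le: "k1 k \<le> h" "k2 k \<le> e" if "k \<in> K" for k
    using that fin by (auto simp: h e)
  have bound: "i \<le> h \<and> j \<le> e" if "(i, j) \<in> ?P" for i j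
    using top_pairs_above[OF ctxt that] le unfolding T by force
  \<comment> \<open>Replace the larger variable in the member of StaG whose first entry is h by
    x_h.\<close>
  have square: "(h, h) \<in> ?P"
    using pairs_move[OF ctxt KP[OF kh(1)], of h] KP[OF kh(1)] kh(2)
    by (cases "k2 kh = h") (auto simp: pairs_def[OF ctxt])
  \<comment> \<open>The moves lead from (h, h) to (j, h), then to (j, j), then to (i, j).\<close>
  have triangle: "(i, j) \<in> ?P" if "1 \<le> i" "i \<le> j" "j \<le> h" for i j
  proof -
    have "(j, h) \<in> ?P"
      using pairs_move[OF ctxt square, of j] square that by (cases "j = h") auto
    then have "(j, j) \<in> ?P"
      using pairs_move[OF ctxt, of j h j] that by (cases "j = h") auto
    then show ?thesis
      using pairs_move[OF ctxt, of j j i] that by (cases "i = j") auto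
  qed
  have h1: "1 \<le> h" and en: "e \<le> n"
    using KP[OF kh(1)] KP[OF ke(1)] kh(2) ke(2) by (auto simp: pairs_def[OF ctxt])
  have he: "h \<le> e"
    using le(2)[OF kh(1)] KP[OF kh(1)] kh(2) by (auto simp: pairs_def[OF ctxt])
  define Y' where "Y' = (\<lambda>j. {i. (i, j) \<in> ?P})"
  have Y': "Y' j = Y j" if "h < j" "j \<le> e" for j
  proof -
    have j: "j \<in> {1..n}" using that h1 en by auto
    show ?thesis
      unfolding Y'_def assms(10)[OF j] using mgP by (auto simp: pairs_def[OF ctxt])
  qed
  \<comment> \<open>The member of StaG with second entry e has first entry at most h < j, so
    lowering e to j keeps the pair ordered.\<close>
  have Yne: "Y' j \<noteq> {}" if "h < j" "j \<le> e" for j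
  proof -
    have "(k1 ke, e) \<in> ?P" "k1 ke \<le> h"
      using KP[OF ke(1)] ke(2) le(1)[OF ke(1)] by auto
    then have "(k1 ke, j) \<in> ?P"
      using pairs_move[OF ctxt, of "k1 ke" e j] that by (cases "j = e") auto
    then show ?thesis by (auto simp: Y'_def)
  qed
  have fits: "fits n a p" if "p \<in> ?P" for p
  proof -
    obtain i j where p: "p = (i, j)" by (cases p)
    then have ij: "1 \<le> i" "i \<le> j" "j \<le> n"
      using that by (auto simp: pairs_def[OF ctxt])
    then have "xmon (pexp i j) divides\<^bsub>polyR n\<^esub> (xmon a :: 'k mpol)"
      using assms(5) mgP[of i j] that p by (auto simp: determined_def xvar_mult_xvar)
    then obtain c where c: "(xmon a :: 'k mpol) = xmon (pexp i j) * c"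
      by (auto simp: factor_def polyR_simps)
    have "Poly_Mapping.keys (xmon a :: 'k mpol) = (+) (pexp i j) ` Poly_Mapping.keys c"
      unfolding c by (rule keys_xmon_mult)
    then obtain b where "a = pexp i j + b" by auto
    then show ?thesis
      using ij by (auto simp: fits_def p lookup_add)
  qed
  have dual: "adual n a I = dual_ideal n a ?P"
  proof -
    have "{xmon (a - b) | b. xmon b \<in> mgens n I} = (xmon ` (\<lambda>(i, j). a - pexp i j) ` ?P :: 'k mpol set)"
      by (force simp: mg xmon_mem_image minexps_pairs[OF ctxt])
    moreover have "(\<lambda>(i, j). a - pexp i j) ` ?P \<subseteq> expos n"
      using expos_minus[OF assms(1)] by auto
    ultimately show ?thesis
      by (simp add: adual_def dual_ideal_def genideal_xmon)
  qed
  have all: "{(k, l) \<in> ?P. l \<le> e} = ?P"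
    using bound by auto
  obtain x y where xy: "lin_betti n (int (mdeg a) - 2) (adual n a I) x y"
      "int y = (\<Sum>l=2..h. int l - 2) + (\<Sum>l=h+1..e. int (card (Y' l)) - 1)"
      "int x = 2 * int y + 2 * (int h - 1) + (int e - int h)"
    using lin_betti_columns[OF assms(1) fits triangle h1 he bound Y'_def[THEN fun_cong] Yne he order_refl, where 'k = 'k]
    unfolding dual all by blast
  have "(\<Sum>l=h+1..e. int (card (Y' l)) - 1) = (\<Sum>l=h+1..e. int (card (Y l)) - 1)"
    by (intro sum.cong) (auto simp: Y')
  then have y: "int y = w2" and x: "int x = 2 * w2 + w1"
    using xy(2,3) assms(11,12) by simp_all
  have "adual n a I \<subseteq> carrier (polyR n)"
    unfolding dual dual_ideal_def by (rule polys_on_subset_polyR)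
  then have "betti_ideal n (adual n a I) 1 = x" "betti_ideal n (adual n a I) 2 = y"
    using xy(1) lin_res_betti unfolding lin_betti_def
    by (fastforce simp: numeral_2_eq_2 numeral_3_eq_3)+
  \<comment> \<open>Since 1 choose 2 is 0, the claimed values are 2 w_2 + w_1 and w_2.\<close>
  then show ?thesis
    using x y by simp
qed

end
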